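(* Let $(\mathcal{A},\mathcal{B};\theta_*,\theta^* )$ be an $\Omega$-system. Let $X$ and $Y$ be projective objects in $\mathcal{B}$, and let $f\in\mathrm{Mor}_{\mathcal{B}}(X,Y)$. Let $$\cdots\xrightarrow{\partial_2}P_1\xrightarrow{\partial_1}P_0\xrightarrow{\varepsilon}\theta^*(X)\to0\quad\text{and}\quad\cdots\xrightarrow{\partial'_2}P'_1\xrightarrow{\partial'_1}P'_0\xrightarrow{\varepsilon'}\theta^*(Y)\to0$$ be chain complexes in $\mathcal{A}$ such that: (i) each $P_n$ ($n\ge0$) is projective in $\mathcal{A}$, and the complex obtained by applying $\theta_*$ to the first (augmented) complex is exact; (ii) $H_n(P'_*,\partial'_* )$ is isomorphic to an object in $\theta^*(\mathcal{B})$ for each $n\ge0$, and $\varepsilon'$ induces an isomorphism $H_0(P'_*,\partial'_* )\cong\theta^*(Y)$. Then there are morphisms $f_n\in\mathrm{Mor}_{\mathcal{A}}(P_n,P'_n)$ for $n\ge0$ such that $\varepsilon'\circ f_0=\theta^*(f)\circ\varepsilon$ and $\partial'_n\circ f_n=f_{n-1}\circ\partial_n$ for all $n\ge1$. Furthermore, $\{f_n\}_{n\in\mathbb{N}}$ is unique up to chain homotopy.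
   Context: An $\Omega$-system $(\mathcal{A},\mathcal{B};\theta_*,\theta^* )$ consists of abelian categories $\mathcal{A},\mathcal{B}$ and additive functors $\theta_*\colon\mathcal{A}\to\mathcal{B}$, $\theta^*\colon\mathcal{B}\to\mathcal{A}$ such that: (OP1) $\theta_*$ is left adjoint to $\theta^*$; (OP2) the counit $\theta_*\circ\theta^*\to\mathrm{Id}_{\mathcal{B}}$ is an isomorphism; (OP3) $\theta^*$ sends epimorphisms in $\mathcal{B}$ to epimorphisms in $\mathcal{A}$. *)

theory Defs
  imports "HOL-Algebra.Group"
begin

section \<open>Categories\<close>

text \<open>
  Every arrow carries its source and target, so that composition needs no object arguments.
  Composition, the identities and the additive structure are total functions whose values are
  constrained (and used) only on composable, respectively parallel, arrows between objects.
\<close>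

record ('o, 'm) cat =
  Obj :: "'o set"
  Arr :: "'m set"
  source :: "'m \<Rightarrow> 'o"
  target :: "'m \<Rightarrow> 'o"
  ident :: "'o \<Rightarrow> 'm"
  cmp :: "'m \<Rightarrow> 'm \<Rightarrow> 'm"  (infixl "\<cdot>\<index>" 70)

definition Mor :: "('o, 'm, 'z) cat_scheme \<Rightarrow> 'o \<Rightarrow> 'o \<Rightarrow> 'm set" where
  "Mor C X Y = {f \<in> Arr C. source C f = X \<and> target C f = Y}"

locale category =
  fixes C :: "('o, 'm, 'z) cat_scheme" (structure)
  assumes source_closed: "f \<in> Arr C \<Longrightarrow> source C f \<in> Obj C"
    and target_closed: "f \<in> Arr C \<Longrightarrow> target C f \<in> Obj C"
    and ident_closed: "X \<in> Obj C \<Longrightarrow> ident C X \<in> Mor C X X"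
    and cmp_closed: "f \<in> Mor C X Y \<Longrightarrow> g \<in> Mor C Y Z \<Longrightarrow> g \<cdot> f \<in> Mor C X Z"
    and cmp_ident_left: "f \<in> Mor C X Y \<Longrightarrow> ident C Y \<cdot> f = f"
    and cmp_ident_right: "f \<in> Mor C X Y \<Longrightarrow> f \<cdot> ident C X = f"
    and cmp_assoc: "f \<in> Mor C W X \<Longrightarrow> g \<in> Mor C X Y \<Longrightarrow> h \<in> Mor C Y Z
                      \<Longrightarrow> (h \<cdot> g) \<cdot> f = h \<cdot> (g \<cdot> f)"

definition is_mono :: "('o, 'm, 'z) cat_scheme \<Rightarrow> 'm \<Rightarrow> bool" where
  "is_mono C f \<longleftrightarrow> f \<in> Arr C \<and>
     (\<forall>W. \<forall>g \<in> Mor C W (source C f). \<forall>h \<in> Mor C W (source C f).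
        f \<cdot>\<^bsub>C\<^esub> g = f \<cdot>\<^bsub>C\<^esub> h \<longrightarrow> g = h)"

definition is_epi :: "('o, 'm, 'z) cat_scheme \<Rightarrow> 'm \<Rightarrow> bool" where
  "is_epi C f \<longleftrightarrow> f \<in> Arr C \<and>
     (\<forall>W. \<forall>g \<in> Mor C (target C f) W. \<forall>h \<in> Mor C (target C f) W.
        g \<cdot>\<^bsub>C\<^esub> f = h \<cdot>\<^bsub>C\<^esub> f \<longrightarrow> g = h)"

definition is_iso :: "('o, 'm, 'z) cat_scheme \<Rightarrow> 'm \<Rightarrow> bool" where
  "is_iso C f \<longleftrightarrow> f \<in> Arr C \<and>
     (\<exists>g \<in> Mor C (target C f) (source C f).
        g \<cdot>\<^bsub>C\<^esub> f = ident C (source C f) \<and> f \<cdot>\<^bsub>C\<^esub> g = ident C (target C f))"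

definition isomorphic :: "('o, 'm, 'z) cat_scheme \<Rightarrow> 'o \<Rightarrow> 'o \<Rightarrow> bool" where
  "isomorphic C X Y \<longleftrightarrow> (\<exists>f \<in> Mor C X Y. is_iso C f)"

definition projective :: "('o, 'm, 'z) cat_scheme \<Rightarrow> 'o \<Rightarrow> bool" where
  "projective C P \<longleftrightarrow> P \<in> Obj C \<and>
     (\<forall>e. is_epi C e \<longrightarrow>
        (\<forall>g \<in> Mor C P (target C e). \<exists>h \<in> Mor C P (source C e). e \<cdot>\<^bsub>C\<^esub> h = g))"

definition is_zero_object :: "('o, 'm, 'z) cat_scheme \<Rightarrow> 'o \<Rightarrow> bool" where
  "is_zero_object C Z \<longleftrightarrow> Z \<in> Obj C \<and>
     (\<forall>X \<in> Obj C. (\<exists>!f. f \<in> Mor C X Z) \<and> (\<exists>!f. f \<in> Mor C Z X))"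

definition zero_object :: "('o, 'm, 'z) cat_scheme \<Rightarrow> 'o" where
  "zero_object C = (SOME Z. is_zero_object C Z)"


section \<open>Abelian categories\<close>

record ('o, 'm) addcat = "('o, 'm) cat" +
  madd :: "'m \<Rightarrow> 'm \<Rightarrow> 'm"  (infixl "\<boxplus>\<index>" 65)
  mzero :: "'o \<Rightarrow> 'o \<Rightarrow> 'm"

text \<open>The group of morphisms from one object to another, written multiplicatively as in
  \<open>HOL-Algebra\<close>: its product is the addition of morphisms.\<close>

definition Mor_group :: "('o, 'm, 'z) addcat_scheme \<Rightarrow> 'o \<Rightarrow> 'o \<Rightarrow> 'm monoid" where
  "Mor_group C X Y = \<lparr>carrier = Mor C X Y, mult = madd C, one = mzero C X Y\<rparr>"

definition mdiff :: "('o, 'm, 'z) addcat_scheme \<Rightarrow> 'm \<Rightarrow> 'm \<Rightarrow> 'm" where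
  "mdiff C f g = f \<boxplus>\<^bsub>C\<^esub> inv\<^bsub>Mor_group C (source C g) (target C g)\<^esub> g"

locale preadditive_category = category C
  for C :: "('o, 'm, 'z) addcat_scheme" (structure) +
  assumes Mor_comm_group: "X \<in> Obj C \<Longrightarrow> Y \<in> Obj C \<Longrightarrow> comm_group (Mor_group C X Y)"
    and cmp_madd_left: "f \<in> Mor C X Y \<Longrightarrow> g \<in> Mor C Y Z \<Longrightarrow> h \<in> Mor C Y Z
                          \<Longrightarrow> (g \<boxplus> h) \<cdot> f = (g \<cdot> f) \<boxplus> (h \<cdot> f)"
    and cmp_madd_right: "f \<in> Mor C X Y \<Longrightarrow> g \<in> Mor C X Y \<Longrightarrow> h \<in> Mor C Y Z
                          \<Longrightarrow> h \<cdot> (f \<boxplus> g) = (h \<cdot> f) \<boxplus> (h \<cdot> g)"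

definition is_biproduct ::
  "('o, 'm, 'z) addcat_scheme \<Rightarrow> 'o \<Rightarrow> 'o \<Rightarrow> 'o \<Rightarrow> 'm \<Rightarrow> 'm \<Rightarrow> 'm \<Rightarrow> 'm \<Rightarrow> bool" where
  "is_biproduct C X Y S i j p q \<longleftrightarrow>
     i \<in> Mor C X S \<and> j \<in> Mor C Y S \<and> p \<in> Mor C S X \<and> q \<in> Mor C S Y \<and>
     p \<cdot>\<^bsub>C\<^esub> i = ident C X \<and> q \<cdot>\<^bsub>C\<^esub> j = ident C Y \<and>
     p \<cdot>\<^bsub>C\<^esub> j = mzero C Y X \<and> q \<cdot>\<^bsub>C\<^esub> i = mzero C X Y \<and>
     (i \<cdot>\<^bsub>C\<^esub> p) \<boxplus>\<^bsub>C\<^esub> (j \<cdot>\<^bsub>C\<^esub> q) = ident C S"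

definition is_kernel :: "('o, 'm, 'z) addcat_scheme \<Rightarrow> 'm \<Rightarrow> 'm \<Rightarrow> bool" where
  "is_kernel C f k \<longleftrightarrow> f \<in> Arr C \<and> k \<in> Mor C (source C k) (source C f) \<and>
     f \<cdot>\<^bsub>C\<^esub> k = mzero C (source C k) (target C f) \<and>
     (\<forall>W. \<forall>h \<in> Mor C W (source C f). f \<cdot>\<^bsub>C\<^esub> h = mzero C W (target C f) \<longrightarrow>
        (\<exists>!u. u \<in> Mor C W (source C k) \<and> k \<cdot>\<^bsub>C\<^esub> u = h))"

definition is_cokernel :: "('o, 'm, 'z) addcat_scheme \<Rightarrow> 'm \<Rightarrow> 'm \<Rightarrow> bool" where
  "is_cokernel C f c \<longleftrightarrow> f \<in> Arr C \<and> c \<in> Mor C (target C f) (target C c) \<and>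
     c \<cdot>\<^bsub>C\<^esub> f = mzero C (source C f) (target C c) \<and>
     (\<forall>W. \<forall>h \<in> Mor C (target C f) W. h \<cdot>\<^bsub>C\<^esub> f = mzero C (source C f) W \<longrightarrow>
        (\<exists>!u. u \<in> Mor C (target C c) W \<and> u \<cdot>\<^bsub>C\<^esub> c = h))"

locale abelian_category = preadditive_category C
  for C :: "('o, 'm, 'z) addcat_scheme" (structure) +
  assumes ex_zero_object: "\<exists>Z. is_zero_object C Z"
    and ex_biproduct: "X \<in> Obj C \<Longrightarrow> Y \<in> Obj C \<Longrightarrow> \<exists>S i j p q. is_biproduct C X Y S i j p q"
    and ex_kernel: "f \<in> Arr C \<Longrightarrow> \<exists>k. is_kernel C f k"
    and ex_cokernel: "f \<in> Arr C \<Longrightarrow> \<exists>c. is_cokernel C f c"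
    and mono_normal: "is_mono C f \<Longrightarrow> \<exists>g. is_kernel C g f"
    and epi_normal: "is_epi C f \<Longrightarrow> \<exists>g. is_cokernel C g f"

definition is_image :: "('o, 'm, 'z) addcat_scheme \<Rightarrow> 'm \<Rightarrow> 'm \<Rightarrow> bool" where
  "is_image C f i \<longleftrightarrow> (\<exists>c. is_cokernel C f c \<and> is_kernel C c i)"

text \<open>Exactness at the middle object of \<open>W \<rightarrow> X \<rightarrow> Y\<close>: the image of the first arrow \<open>f\<close> and the
  kernel of the second arrow \<open>g\<close> are the same subobject.\<close>

definition exact_pair :: "('o, 'm, 'z) addcat_scheme \<Rightarrow> 'm \<Rightarrow> 'm \<Rightarrow> bool" where
  "exact_pair C f g \<longleftrightarrow> (\<exists>k. is_image C f k \<and> is_kernel C g k)"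


section \<open>Functors and \<open>\<Omega>\<close>-systems\<close>

record ('o1, 'm1, 'o2, 'm2) cat_map =
  omap :: "'o1 \<Rightarrow> 'o2"
  amap :: "'m1 \<Rightarrow> 'm2"

locale additive_functor =
  C: preadditive_category C + D: preadditive_category D
  for C :: "('o1, 'm1, 'z1) addcat_scheme"
    and D :: "('o2, 'm2, 'z2) addcat_scheme"
    and F :: "('o1, 'm1, 'o2, 'm2) cat_map" +
  assumes omap_closed: "X \<in> Obj C \<Longrightarrow> omap F X \<in> Obj D"
    and amap_closed: "f \<in> Mor C X Y \<Longrightarrow> amap F f \<in> Mor D (omap F X) (omap F Y)"
    and amap_ident: "X \<in> Obj C \<Longrightarrow> amap F (ident C X) = ident D (omap F X)"
    and amap_cmp: "f \<in> Mor C X Y \<Longrightarrow> g \<in> Mor C Y Z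
                     \<Longrightarrow> amap F (g \<cdot>\<^bsub>C\<^esub> f) = amap F g \<cdot>\<^bsub>D\<^esub> amap F f"
    and amap_additive: "X \<in> Obj C \<Longrightarrow> Y \<in> Obj C
                     \<Longrightarrow> amap F \<in> hom (Mor_group C X Y) (Mor_group D (omap F X) (omap F Y))"

text \<open>\<open>L\<close> is left adjoint to \<open>R\<close>, with unit \<open>\<eta>\<close> and counit \<open>\<epsilon>\<close>.\<close>

locale adjunction =
  L: additive_functor A B L + R: additive_functor B A R
  for A :: "('o1, 'm1, 'z1) addcat_scheme"
    and B :: "('o2, 'm2, 'z2) addcat_scheme"
    and L :: "('o1, 'm1, 'o2, 'm2) cat_map"
    and R :: "('o2, 'm2, 'o1, 'm1) cat_map"
    and \<eta> :: "'o1 \<Rightarrow> 'm1"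
    and \<epsilon> :: "'o2 \<Rightarrow> 'm2" +
  assumes unit_closed: "X \<in> Obj A \<Longrightarrow> \<eta> X \<in> Mor A X (omap R (omap L X))"
    and unit_natural: "f \<in> Mor A X X'
                         \<Longrightarrow> \<eta> X' \<cdot>\<^bsub>A\<^esub> f = amap R (amap L f) \<cdot>\<^bsub>A\<^esub> \<eta> X"
    and counit_closed: "Y \<in> Obj B \<Longrightarrow> \<epsilon> Y \<in> Mor B (omap L (omap R Y)) Y"
    and counit_natural: "g \<in> Mor B Y Y'
                         \<Longrightarrow> \<epsilon> Y' \<cdot>\<^bsub>B\<^esub> amap L (amap R g) = g \<cdot>\<^bsub>B\<^esub> \<epsilon> Y"
    and triangle_left: "X \<in> Obj A \<Longrightarrow> \<epsilon> (omap L X) \<cdot>\<^bsub>B\<^esub> amap L (\<eta> X) = ident B (omap L X)"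
    and triangle_right: "Y \<in> Obj B \<Longrightarrow> amap R (\<epsilon> Y) \<cdot>\<^bsub>A\<^esub> \<eta> (omap R Y) = ident A (omap R Y)"

text \<open>The functor written with a lower star is \<open>\<theta>\<^sub>l\<close>, the one with an upper star is \<open>\<theta>\<^sub>u\<close>.
  Whether the counit is an isomorphism does not depend on the chosen adjunction.\<close>

locale omega_system =
  A: abelian_category A + B: abelian_category B +
  lower: additive_functor A B \<theta>\<^sub>l + upper: additive_functor B A \<theta>\<^sub>u
  for A :: "('o1, 'm1, 'z1) addcat_scheme"
    and B :: "('o2, 'm2, 'z2) addcat_scheme"
    and \<theta>\<^sub>l :: "('o1, 'm1, 'o2, 'm2) cat_map"
    and \<theta>\<^sub>u :: "('o2, 'm2, 'o1, 'm1) cat_map" +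
  assumes OP1_OP2: "\<exists>\<eta> \<epsilon>. adjunction A B \<theta>\<^sub>l \<theta>\<^sub>u \<eta> \<epsilon> \<and> (\<forall>Y \<in> Obj B. is_iso B (\<epsilon> Y))"
    and OP3: "is_epi B e \<Longrightarrow> is_epi A (amap \<theta>\<^sub>u e)"


section \<open>Chain complexes\<close>

text \<open>A complex \<open>\<dots> \<rightarrow> P 1 \<rightarrow> P 0 \<rightarrow> X \<rightarrow> 0\<close> with differentials \<open>d n\<close> from \<open>P n\<close> to \<open>P (n - 1)\<close> for
  \<open>n \<ge> 1\<close> and augmentation \<open>e\<close>. The value \<open>d 0\<close> is arbitrary and never used.\<close>

definition augmented_complex ::
  "('o, 'm, 'z) addcat_scheme \<Rightarrow> (nat \<Rightarrow> 'o) \<Rightarrow> (nat \<Rightarrow> 'm) \<Rightarrow> 'm \<Rightarrow> 'o \<Rightarrow> bool" where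
  "augmented_complex C P d e X \<longleftrightarrow>
     X \<in> Obj C \<and> (\<forall>n. P n \<in> Obj C) \<and>
     e \<in> Mor C (P 0) X \<and> (\<forall>n\<ge>1. d n \<in> Mor C (P n) (P (n - 1))) \<and>
     e \<cdot>\<^bsub>C\<^esub> d 1 = mzero C (P 1) X \<and>
     (\<forall>n\<ge>1. d n \<cdot>\<^bsub>C\<^esub> d (n + 1) = mzero C (P (n + 1)) (P (n - 1)))"

definition augmented_exact ::
  "('o, 'm, 'z) addcat_scheme \<Rightarrow> (nat \<Rightarrow> 'm) \<Rightarrow> 'm \<Rightarrow> 'o \<Rightarrow> bool" where
  "augmented_exact C d e X \<longleftrightarrow>
     exact_pair C e (mzero C X (zero_object C)) \<and>
     exact_pair C (d 1) e \<and>
     (\<forall>n\<ge>1. exact_pair C (d (n + 1)) (d n))"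

text \<open>The differentials of the complex \<open>\<dots> \<rightarrow> P 1 \<rightarrow> P 0 \<rightarrow> 0\<close> without its augmentation.\<close>

definition boundary ::
  "('o, 'm, 'z) addcat_scheme \<Rightarrow> (nat \<Rightarrow> 'o) \<Rightarrow> (nat \<Rightarrow> 'm) \<Rightarrow> nat \<Rightarrow> 'm" where
  "boundary C P d n = (if n = 0 then mzero C (P 0) (zero_object C) else d n)"

text \<open>The homology in degree \<open>n\<close>, presented by the inclusion \<open>k\<close> of the cycles into \<open>P n\<close> and the
  projection \<open>q\<close> of the cycles onto their quotient by the boundaries. The homology object is
  \<open>target C q\<close>; like kernels and cokernels, it is determined up to isomorphism only.\<close>

definition is_homology ::
  "('o, 'm, 'z) addcat_scheme \<Rightarrow> (nat \<Rightarrow> 'o) \<Rightarrow> (nat \<Rightarrow> 'm) \<Rightarrow> nat \<Rightarrow> 'm \<Rightarrow> 'm \<Rightarrow> bool" where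
  "is_homology C P d n k q \<longleftrightarrow>
     is_kernel C (boundary C P d n) k \<and>
     (\<exists>u \<in> Mor C (P (n + 1)) (source C k).
        k \<cdot>\<^bsub>C\<^esub> u = boundary C P d (n + 1) \<and> is_cokernel C u q)"

definition homology_isomorphic ::
  "('o, 'm, 'z) addcat_scheme \<Rightarrow> (nat \<Rightarrow> 'o) \<Rightarrow> (nat \<Rightarrow> 'm) \<Rightarrow> nat \<Rightarrow> 'o \<Rightarrow> bool" where
  "homology_isomorphic C P d n W \<longleftrightarrow>
     (\<exists>k q. is_homology C P d n k q \<and> isomorphic C (target C q) W)"

definition induces_H0_iso ::
  "('o, 'm, 'z) addcat_scheme \<Rightarrow> (nat \<Rightarrow> 'o) \<Rightarrow> (nat \<Rightarrow> 'm) \<Rightarrow> 'm \<Rightarrow> 'o \<Rightarrow> bool" where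
  "induces_H0_iso C P d e X \<longleftrightarrow>
     (\<exists>k q. is_homology C P d 0 k q \<and>
        (\<exists>t \<in> Mor C (target C q) X. t \<cdot>\<^bsub>C\<^esub> q = e \<cdot>\<^bsub>C\<^esub> k \<and> is_iso C t))"

definition chain_map_over ::
  "('o, 'm, 'z) addcat_scheme \<Rightarrow> (nat \<Rightarrow> 'o) \<Rightarrow> (nat \<Rightarrow> 'm) \<Rightarrow> 'm
     \<Rightarrow> (nat \<Rightarrow> 'o) \<Rightarrow> (nat \<Rightarrow> 'm) \<Rightarrow> 'm \<Rightarrow> 'm \<Rightarrow> (nat \<Rightarrow> 'm) \<Rightarrow> bool" where
  "chain_map_over C P d e P' d' e' \<phi> f \<longleftrightarrow>
     (\<forall>n. f n \<in> Mor C (P n) (P' n)) \<and>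
     e' \<cdot>\<^bsub>C\<^esub> f 0 = \<phi> \<cdot>\<^bsub>C\<^esub> e \<and>
     (\<forall>n\<ge>1. d' n \<cdot>\<^bsub>C\<^esub> f n = f (n - 1) \<cdot>\<^bsub>C\<^esub> d n)"

definition chain_homotopic ::
  "('o, 'm, 'z) addcat_scheme \<Rightarrow> (nat \<Rightarrow> 'o) \<Rightarrow> (nat \<Rightarrow> 'm)
     \<Rightarrow> (nat \<Rightarrow> 'o) \<Rightarrow> (nat \<Rightarrow> 'm) \<Rightarrow> (nat \<Rightarrow> 'm) \<Rightarrow> (nat \<Rightarrow> 'm) \<Rightarrow> bool" where
  "chain_homotopic C P d P' d' f g \<longleftrightarrow>
     (\<exists>h. (\<forall>n. h n \<in> Mor C (P n) (P' (n + 1))) \<and>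
        mdiff C (f 0) (g 0) = d' 1 \<cdot>\<^bsub>C\<^esub> h 0 \<and>
        (\<forall>n\<ge>1. mdiff C (f n) (g n) =
                  (d' (n + 1) \<cdot>\<^bsub>C\<^esub> h n) \<boxplus>\<^bsub>C\<^esub> (h (n - 1) \<cdot>\<^bsub>C\<^esub> d n)))"

end

theory Submission
  imports Defs
begin

text \<open>
  Since \<open>\<theta>\<^sub>u\<close> preserves epimorphisms, its left adjoint \<open>\<theta>\<^sub>l\<close> preserves projectives, and
  \<open>\<theta>\<^sub>l (\<theta>\<^sub>u X) \<cong> X\<close> is projective as well. The exact complex \<open>\<theta>\<^sub>l P \<rightarrow> \<theta>\<^sub>l (\<theta>\<^sub>u X) \<rightarrow> 0\<close> therefore splits, so
  by adjunction the cochain complex of morphisms from \<open>P\<close> to \<open>\<theta>\<^sub>u W\<close> is exact in positive degrees,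
  for every \<open>W\<close>. The obstruction to extending a partial chain map or homotopy
  by one more degree is a cocycle with values in the homology of \<open>P'\<close>, which has the form \<open>\<theta>\<^sub>u W\<close>; it is
  thus a coboundary and disappears after changing the last component already constructed by
  a morphism into the cycles.
\<close>

section \<open>Arithmetic of morphisms\<close>

context category
begin

lemma Mor_Obj:
  assumes "f \<in> Mor C X Y"
  shows "X \<in> Obj C" and "Y \<in> Obj C"
  using assms source_closed target_closed unfolding Mor_def by auto

lemma Mor_source: "f \<in> Mor C X Y \<Longrightarrow> source C f = X"
  and Mor_target: "f \<in> Mor C X Y \<Longrightarrow> target C f = Y"
  and Mor_Arr: "f \<in> Mor C X Y \<Longrightarrow> f \<in> Arr C"
  unfolding Mor_def by auto

lemma epi_iff:
  assumes "f \<in> Mor C X Y"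
  shows "is_epi C f \<longleftrightarrow> (\<forall>W. \<forall>g \<in> Mor C Y W. \<forall>h \<in> Mor C Y W. g \<cdot> f = h \<cdot> f \<longrightarrow> g = h)"
  using assms unfolding is_epi_def Mor_def by auto

lemma mono_iff:
  assumes "f \<in> Mor C X Y"
  shows "is_mono C f \<longleftrightarrow> (\<forall>W. \<forall>g \<in> Mor C W X. \<forall>h \<in> Mor C W X. f \<cdot> g = f \<cdot> h \<longrightarrow> g = h)"
  using assms unfolding is_mono_def Mor_def by auto

lemma iso_inverse:
  assumes "is_iso C t" and "t \<in> Mor C X Y"
  obtains t' where "t' \<in> Mor C Y X" "t' \<cdot> t = ident C X" "t \<cdot> t' = ident C Y"
  using assms unfolding is_iso_def Mor_def by auto

lemma iso_mono:
  assumes t: "is_iso C t" "t \<in> Mor C X Y"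
  shows "is_mono C t"
proof -
  obtain t' where t': "t' \<in> Mor C Y X" "t' \<cdot> t = ident C X"
    using iso_inverse[OF t] by metis
  have "a = b" if a: "a \<in> Mor C W X" and b: "b \<in> Mor C W X" and eq: "t \<cdot> a = t \<cdot> b" for W a b
    using cmp_assoc[OF a t(2) t'(1)] cmp_assoc[OF b t(2) t'(1)] eq t'(2)
      cmp_ident_left[OF a] cmp_ident_left[OF b] by simp
  then show ?thesis
    using mono_iff[OF t(2)] by blast
qed

lemma iso_cmp_epi:
  assumes t: "is_iso C t" "t \<in> Mor C Y Z" and q: "is_epi C q" "q \<in> Mor C X Y"
  shows "is_epi C (t \<cdot> q)"
proof -
  obtain t' where t': "t' \<in> Mor C Z Y" "t \<cdot> t' = ident C Z"
    using iso_inverse[OF t] by metis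
  have "g = h" if g: "g \<in> Mor C Z W" and h: "h \<in> Mor C Z W" and eq: "g \<cdot> (t \<cdot> q) = h \<cdot> (t \<cdot> q)"
    for W g h
  proof -
    have "(g \<cdot> t) \<cdot> q = (h \<cdot> t) \<cdot> q"
      using eq cmp_assoc[OF q(2) t(2) g] cmp_assoc[OF q(2) t(2) h] by simp
    then have "g \<cdot> t = h \<cdot> t"
      using q(1) cmp_closed[OF t(2) g] cmp_closed[OF t(2) h] unfolding epi_iff[OF q(2)] by blast
    then have "g \<cdot> (t \<cdot> t') = h \<cdot> (t \<cdot> t')"
      using cmp_assoc[OF t'(1) t(2) g] cmp_assoc[OF t'(1) t(2) h] by simp
    then show ?thesis
      using t'(2) cmp_ident_right g h by simp
  qed
  then show ?thesis
    using epi_iff[OF cmp_closed[OF q(2) t(2)]] by blast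
qed

lemma mono_cmp:
  assumes f: "is_mono C f" "f \<in> Mor C X Y" and g: "is_mono C g" "g \<in> Mor C Y Z"
  shows "is_mono C (g \<cdot> f)"
proof -
  have "a = b" if a: "a \<in> Mor C W X" and b: "b \<in> Mor C W X" and eq: "(g \<cdot> f) \<cdot> a = (g \<cdot> f) \<cdot> b"
    for W a b
  proof -
    have "g \<cdot> (f \<cdot> a) = g \<cdot> (f \<cdot> b)"
      using eq cmp_assoc[OF a f(2) g(2)] cmp_assoc[OF b f(2) g(2)] by simp
    then have "f \<cdot> a = f \<cdot> b"
      using g(1) cmp_closed[OF a f(2)] cmp_closed[OF b f(2)] unfolding mono_iff[OF g(2)] by blast
    then show ?thesis
      using f(1) a b unfolding mono_iff[OF f(2)] by blast
  qed
  then show ?thesis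
    using mono_iff[OF cmp_closed[OF f(2) g(2)]] by blast
qed

lemma projective_lift:
  assumes "projective C Q" and "is_epi C p" and "p \<in> Mor C X Y" and "g \<in> Mor C Q Y"
  obtains h where "h \<in> Mor C Q X" "p \<cdot> h = g"
  using assms unfolding projective_def Mor_def by blast

lemma projective_iso:
  assumes t: "is_iso C t" "t \<in> Mor C X Y" and Y: "projective C Y"
  shows "projective C X"
  unfolding projective_def
proof (intro conjI allI impI ballI)
  show "X \<in> Obj C"
    using Mor_Obj[OF t(2)] by simp
  fix p g assume p: "is_epi C p" and g: "g \<in> Mor C X (target C p)"
  have pM: "p \<in> Mor C (source C p) (target C p)"
    using p unfolding is_epi_def Mor_def by simp
  obtain t' where t': "t' \<in> Mor C Y X" "t' \<cdot> t = ident C X"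
    using iso_inverse[OF t] by metis
  obtain h where h: "h \<in> Mor C Y (source C p)" "p \<cdot> h = g \<cdot> t'"
    using projective_lift[OF Y p pM cmp_closed[OF t'(1) g]] by metis
  have "p \<cdot> (h \<cdot> t) = g"
    using cmp_assoc[OF t(2) h(1) pM] cmp_assoc[OF t(2) t'(1) g] h(2) t'(2) cmp_ident_right[OF g]
    by simp
  then show "\<exists>h \<in> Mor C X (source C p). p \<cdot> h = g"
    using cmp_closed[OF t(2) h(1)] by blast
qed

end

section \<open>Subtraction of morphisms and its compatibility with composition\<close>

context preadditive_category
begin

lemma mzero_closed: "X \<in> Obj C \<Longrightarrow> Y \<in> Obj C \<Longrightarrow> mzero C X Y \<in> Mor C X Y"
  using Group.monoid.one_closed[of "Mor_group C X Y"] Mor_comm_group[of X Y]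
  unfolding comm_group_def comm_monoid_def Mor_group_def by auto

text \<open>\<open>mdiff\<close> takes its inverse in the group named by the source and target of
  \<open>g\<close>. Naming that group as \<open>Mor_group C X Y\<close> lets the group laws of
  \<open>HOL-Algebra\<close> apply.\<close>

lemma mdiff_Mor_group:
  assumes "g \<in> Mor C X Y"
  shows "mdiff C f g = f \<otimes>\<^bsub>Mor_group C X Y\<^esub> inv\<^bsub>Mor_group C X Y\<^esub> g"
  using assms unfolding mdiff_def by (simp add: Mor_group_def Mor_source Mor_target)

lemma
  assumes f: "f \<in> Mor C X Y"
  shows madd_mzero_left: "mzero C X Y \<boxplus> f = f"
    and madd_mzero_right: "f \<boxplus> mzero C X Y = f"
    and mdiff_mzero: "mdiff C f (mzero C X Y) = f"
    and mdiff_self: "mdiff C f f = mzero C X Y"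
proof -
  interpret G: comm_group "Mor_group C X Y"
    using Mor_comm_group Mor_Obj[OF f] by blast
  \<comment> \<open>\<open>sel\<close> translates between the multiplicative names of the group and
    the additive names of the category. It is flipped where the simplifier has to cancel inverses in
    the group.\<close>
  have sel: "carrier (Mor_group C X Y) = Mor C X Y" "mult (Mor_group C X Y) = madd C"
    "one (Mor_group C X Y) = mzero C X Y"
    by (simp_all add: Mor_group_def)
  show "mzero C X Y \<boxplus> f = f" "f \<boxplus> mzero C X Y = f"
    using G.l_one[of f] G.r_one[of f] f by (simp_all add: sel)
  show "mdiff C f (mzero C X Y) = f" "mdiff C f f = mzero C X Y"
    using f G.one_closed G.inv_one G.r_one[of f] G.r_inv[of f]
    by (simp_all add: mdiff_Mor_group[of _ X Y] flip: sel)
qed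

lemma
  assumes f: "f \<in> Mor C X Y" and g: "g \<in> Mor C X Y"
  shows madd_closed: "f \<boxplus> g \<in> Mor C X Y"
    and madd_commute: "f \<boxplus> g = g \<boxplus> f"
    and mdiff_closed: "mdiff C f g \<in> Mor C X Y"
    and mdiff_madd: "mdiff C f g \<boxplus> g = f"
    and madd_mdiff: "mdiff C (f \<boxplus> g) g = f"
    and mdiff_eq_mzeroD: "mdiff C f g = mzero C X Y \<Longrightarrow> f = g"
proof -
  interpret G: comm_group "Mor_group C X Y"
    using Mor_comm_group Mor_Obj[OF f] by blast
  have sel: "carrier (Mor_group C X Y) = Mor C X Y" "mult (Mor_group C X Y) = madd C"
    "one (Mor_group C X Y) = mzero C X Y"
    by (simp_all add: Mor_group_def)
  show "f \<boxplus> g \<in> Mor C X Y" "f \<boxplus> g = g \<boxplus> f"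
    using G.m_closed[of f g] G.m_comm[of f g] f g by (simp_all add: sel)
  show "mdiff C f g \<in> Mor C X Y"
    using f g G.m_closed[of f "inv\<^bsub>Mor_group C X Y\<^esub> g"] G.inv_closed[of g]
    by (simp add: mdiff_Mor_group[OF g] sel)
  show m: "mdiff C f g \<boxplus> g = f"
    using f g G.m_assoc[of f "inv\<^bsub>Mor_group C X Y\<^esub> g" g]
    by (simp add: mdiff_Mor_group[OF g] flip: sel)
  show "mdiff C (f \<boxplus> g) g = f"
    using f g G.m_assoc[of f g "inv\<^bsub>Mor_group C X Y\<^esub> g"]
    by (simp add: mdiff_Mor_group[OF g] flip: sel)
  show "f = g" if "mdiff C f g = mzero C X Y"
    using m that g G.l_one[of g] by (simp add: sel)
qed

lemma madd_assoc:
  assumes "f \<in> Mor C X Y" and "g \<in> Mor C X Y" and "h \<in> Mor C X Y"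
  shows "(f \<boxplus> g) \<boxplus> h = f \<boxplus> (g \<boxplus> h)"
proof -
  interpret G: comm_group "Mor_group C X Y"
    using Mor_comm_group Mor_Obj[OF assms(1)] by blast
  show ?thesis
    using assms G.m_assoc[of f g h] by (simp add: Mor_group_def)
qed

text \<open>Distributivity applied to \<open>mdiff C g h \<boxplus> h\<close>, which equals
  \<open>g\<close>; subtracting \<open>h \<cdot> f\<close> on both sides leaves the claim.\<close>

lemma cmp_mdiff_left:
  assumes f: "f \<in> Mor C X Y" and g: "g \<in> Mor C Y Z" and h: "h \<in> Mor C Y Z"
  shows "mdiff C g h \<cdot> f = mdiff C (g \<cdot> f) (h \<cdot> f)"
  using cmp_madd_left[OF f mdiff_closed[OF g h] h] mdiff_madd[OF g h]
    madd_mdiff[OF cmp_closed[OF f mdiff_closed[OF g h]] cmp_closed[OF f h]] by simp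

lemma cmp_mdiff_right:
  assumes f: "f \<in> Mor C X Y" and g: "g \<in> Mor C X Y" and h: "h \<in> Mor C Y Z"
  shows "h \<cdot> mdiff C f g = mdiff C (h \<cdot> f) (h \<cdot> g)"
  using cmp_madd_right[OF mdiff_closed[OF f g] g h] mdiff_madd[OF f g]
    madd_mdiff[OF cmp_closed[OF mdiff_closed[OF f g] h] cmp_closed[OF g h]] by simp

text \<open>The zero morphism is its own difference with itself, so its composite is the difference
  of one arrow with itself.\<close>

lemma cmp_mzero_left:
  assumes f: "f \<in> Mor C X Y" and Z: "Z \<in> Obj C"
  shows "mzero C Y Z \<cdot> f = mzero C X Z"
proof -
  have z: "mzero C Y Z \<in> Mor C Y Z"
    using mzero_closed Mor_Obj[OF f] Z by blast
  show ?thesis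
    using cmp_mdiff_left[OF f z z] mdiff_self[OF z] mdiff_self[OF cmp_closed[OF f z]]
    by simp
qed

lemma cmp_mzero_right:
  assumes f: "f \<in> Mor C Y Z" and X: "X \<in> Obj C"
  shows "f \<cdot> mzero C X Y = mzero C X Z"
proof -
  have z: "mzero C X Y \<in> Mor C X Y"
    using mzero_closed Mor_Obj[OF f] X by blast
  show ?thesis
    using cmp_mdiff_right[OF z z f] mdiff_self[OF z] mdiff_self[OF cmp_closed[OF z f]]
    by simp
qed

section \<open>Kernels and cokernels\<close>

lemma kernel_lift:
  assumes "is_kernel C f k" and "f \<in> Mor C X Y" and "h \<in> Mor C W X" and "f \<cdot> h = mzero C W Y"
  obtains u where "u \<in> Mor C W (source C k)" "k \<cdot> u = h"
  using assms unfolding is_kernel_def Mor_def by blast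

lemma kernel_closed:
  assumes "is_kernel C f k" and "f \<in> Mor C X Y"
  shows "k \<in> Mor C (source C k) X" and "f \<cdot> k = mzero C (source C k) Y"
  using assms unfolding is_kernel_def Mor_def by auto

lemma cokernel_closed:
  assumes "is_cokernel C f c" and "f \<in> Mor C X Y"
  shows "c \<in> Mor C Y (target C c)" and "c \<cdot> f = mzero C X (target C c)"
  using assms unfolding is_cokernel_def Mor_def by auto

lemma cokernel_factor:
  assumes "is_cokernel C f c" and "f \<in> Mor C X Y" and "h \<in> Mor C Y W" and "h \<cdot> f = mzero C X W"
  obtains u where "u \<in> Mor C (target C c) W" "u \<cdot> c = h"
  using assms unfolding is_cokernel_def Mor_def by blast

text \<open>Two arrows with equal composites are two factorizations of one arrow through the kernel,
  and such a factorization is unique.\<close>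

lemma kernel_mono:
  assumes k: "is_kernel C f k"
  shows "is_mono C k"
proof -
  define X Y K where "X = source C f" and "Y = target C f" and "K = source C k"
  have f: "f \<in> Mor C X Y"
    using k unfolding is_kernel_def Mor_def X_def Y_def by simp
  have kM: "k \<in> Mor C K X" and fk: "f \<cdot> k = mzero C K Y"
    using kernel_closed[OF k f] unfolding K_def by auto
  have "a = b" if a: "a \<in> Mor C W K" and b: "b \<in> Mor C W K" and eq: "k \<cdot> a = k \<cdot> b" for W a b
  proof -
    have "f \<cdot> (k \<cdot> a) = mzero C W Y"
      using cmp_assoc[OF a kM f] fk cmp_mzero_left[OF a] Mor_Obj[OF f] by simp
    then have "\<exists>!u. u \<in> Mor C W K \<and> k \<cdot> u = k \<cdot> a"
      using k cmp_closed[OF a kM] unfolding is_kernel_def X_def Y_def K_def by blast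
    then show ?thesis
      using a b eq by metis
  qed
  then show ?thesis
    using mono_iff[OF kM] by blast
qed

lemma cokernel_epi:
  assumes c: "is_cokernel C f c"
  shows "is_epi C c"
proof -
  define X Y K where "X = source C f" and "Y = target C f" and "K = target C c"
  have f: "f \<in> Mor C X Y"
    using c unfolding is_cokernel_def Mor_def X_def Y_def by simp
  have cM: "c \<in> Mor C Y K" and cf: "c \<cdot> f = mzero C X K"
    using cokernel_closed[OF c f] unfolding K_def by auto
  have "a = b" if a: "a \<in> Mor C K W" and b: "b \<in> Mor C K W" and eq: "a \<cdot> c = b \<cdot> c" for W a b
  proof -
    have "(a \<cdot> c) \<cdot> f = mzero C X W"
      using cmp_assoc[OF f cM a] cf cmp_mzero_right[OF a] Mor_Obj[OF f] by simp
    then have "\<exists>!u. u \<in> Mor C K W \<and> u \<cdot> c = a \<cdot> c"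
      using c cmp_closed[OF cM a] unfolding is_cokernel_def X_def Y_def K_def by blast
    then show ?thesis
      using a b eq by metis
  qed
  then show ?thesis
    using epi_iff[OF cM] by blast
qed

lemma mono_cmp_eq_mzero:
  assumes k: "is_mono C k" "k \<in> Mor C Y Z" and a: "a \<in> Mor C X Y" "k \<cdot> a = mzero C X Z"
  shows "a = mzero C X Y"
  using k a cmp_mzero_right[OF k(2)] mzero_closed Mor_Obj[OF a(1)]
  unfolding mono_iff[OF k(2)] by metis

end


section \<open>Lifting from projective objects\<close>

context abelian_category
begin

lemma zero_object_Obj: "zero_object C \<in> Obj C"
  using someI_ex[OF ex_zero_object] unfolding zero_object_def is_zero_object_def by blast

text \<open>If \<open>w \<cdot> p\<close> is zero, then \<open>f\<close> factors through the kernel of \<open>w\<close>, a subobject of the image. As this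
  subobject is normal, it contains the image, so \<open>w\<close> is zero.\<close>

lemma image_factor_epi:
  assumes f: "f \<in> Mor C X Y" and c: "is_cokernel C f c" and i: "is_kernel C c i"
    and p: "p \<in> Mor C X (source C i)" "i \<cdot> p = f"
  shows "is_epi C p"
proof -
  define I where "I = source C i"
  have cM: "c \<in> Mor C Y (target C c)" and cf: "c \<cdot> f = mzero C X (target C c)"
    using cokernel_closed[OF c f] by auto
  have iM: "i \<in> Mor C I Y" and ci: "c \<cdot> i = mzero C I (target C c)"
    using kernel_closed[OF i cM] unfolding I_def by auto
  have pM: "p \<in> Mor C X I"
    using p unfolding I_def by simp
  have "a = b" if a: "a \<in> Mor C I W" and b: "b \<in> Mor C I W" and eq: "a \<cdot> p = b \<cdot> p" for W a b
  proof -
    define w where "w = mdiff C a b"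
    have w: "w \<in> Mor C I W"
      using mdiff_closed[OF a b] unfolding w_def .
    have wp: "w \<cdot> p = mzero C X W"
      unfolding w_def cmp_mdiff_left[OF pM a b] eq
      using mdiff_self[OF cmp_closed[OF pM b]] .
    obtain j where j: "is_kernel C w j"
      using ex_kernel[OF Mor_Arr[OF w]] by blast
    define J where "J = source C j"
    have jM: "j \<in> Mor C J I" and wj: "w \<cdot> j = mzero C J W"
      using kernel_closed[OF j w] unfolding J_def by auto
    obtain p' where p': "p' \<in> Mor C X J" "j \<cdot> p' = p"
      using kernel_lift[OF j w pM wp] unfolding J_def by metis
    have ijM: "i \<cdot> j \<in> Mor C J Y"
      using cmp_closed[OF jM iM] .
    \<comment> \<open>As \<open>f\<close> factors through \<open>i \<cdot> j\<close>, the arrow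
      \<open>r\<close> kills \<open>f\<close>; it then factors through the cokernel \<open>c\<close>
      and therefore kills \<open>i\<close> as well. So \<open>i\<close> factors through its own
      subobject \<open>i \<cdot> j\<close>, which makes \<open>j\<close> split.\<close>
    obtain r where r: "is_kernel C r (i \<cdot> j)"
      using mono_normal[OF mono_cmp[OF kernel_mono[OF j] jM kernel_mono[OF i] iM]] by blast
    define T where "T = target C r"
    have rM: "r \<in> Mor C Y T"
      using r ijM unfolding is_kernel_def T_def Mor_def by auto
    have rij: "r \<cdot> (i \<cdot> j) = mzero C J T"
      using kernel_closed(2)[OF r rM] Mor_source[OF ijM] by simp
    have "f = (i \<cdot> j) \<cdot> p'"
      using cmp_assoc[OF p'(1) jM iM] p'(2) p(2) by simp
    then have "r \<cdot> f = mzero C X T"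
      using cmp_assoc[OF p'(1) ijM rM] rij cmp_mzero_left[OF p'(1)] Mor_Obj[OF rM] by simp
    then obtain r' where r': "r' \<in> Mor C (target C c) T" "r' \<cdot> c = r"
      using cokernel_factor[OF c f rM] by metis
    have "r \<cdot> i = mzero C I T"
      using cmp_assoc[OF iM cM r'(1)] ci r'(2) cmp_mzero_right[OF r'(1)] Mor_Obj[OF iM] by simp
    then obtain y where y: "y \<in> Mor C I J" "(i \<cdot> j) \<cdot> y = i"
      using kernel_lift[OF r rM iM] Mor_source[OF ijM] by metis
    have "i \<cdot> (j \<cdot> y) = i \<cdot> ident C I"
      using cmp_assoc[OF y(1) jM iM] y(2) cmp_ident_right[OF iM] by simp
    then have jy: "j \<cdot> y = ident C I"
      using kernel_mono[OF i] cmp_closed[OF y(1) jM] ident_closed Mor_Obj[OF iM]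
      unfolding mono_iff[OF iM] by blast
    have "w = w \<cdot> (j \<cdot> y)"
      using jy cmp_ident_right[OF w] by simp
    also have "\<dots> = mzero C I W"
      using cmp_assoc[OF y(1) jM w] wj cmp_mzero_left[OF y(1)] Mor_Obj[OF w] by simp
    finally show ?thesis
      using mdiff_eq_mzeroD[OF a b] unfolding w_def by simp
  qed
  then show ?thesis
    using epi_iff[OF pM] by blast
qed

text \<open>An arrow killed by the cokernel of \<open>f\<close> lands in the image \<open>i\<close>,
  and \<open>f\<close> maps onto that image by the epimorphism \<open>p\<close>, along which a
  projective lifts.\<close>

lemma projective_lift_cokernel:
  assumes Q: "projective C Q" and f: "f \<in> Mor C X Y" and c: "is_cokernel C f c"
    and g: "g \<in> Mor C Q Y" "c \<cdot> g = mzero C Q (target C c)"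
  obtains x where "x \<in> Mor C Q X" "f \<cdot> x = g"
proof -
  have cM: "c \<in> Mor C Y (target C c)" and cf: "c \<cdot> f = mzero C X (target C c)"
    using cokernel_closed[OF c f] by auto
  obtain i where i: "is_kernel C c i"
    using ex_kernel[OF Mor_Arr[OF cM]] by blast
  have iM: "i \<in> Mor C (source C i) Y"
    using kernel_closed[OF i cM] by auto
  obtain p where p: "p \<in> Mor C X (source C i)" "i \<cdot> p = f"
    using kernel_lift[OF i cM f cf] by metis
  obtain g' where g': "g' \<in> Mor C Q (source C i)" "i \<cdot> g' = g"
    using kernel_lift[OF i cM g] by metis
  obtain x where x: "x \<in> Mor C Q X" "p \<cdot> x = g'"
    using projective_lift[OF Q image_factor_epi[OF f c i p] p(1) g'(1)] by metis
  have "f \<cdot> x = g"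
    using cmp_assoc[OF x(1) p(1) iM] p(2) x(2) g'(2) by simp
  then show thesis
    using that x(1) by blast
qed

text \<open>Exactness provides one arrow \<open>k\<close> that is both a kernel of \<open>g\<close>
  and an image of \<open>f\<close>, so whatever \<open>g\<close> kills is also killed by the
  cokernel of \<open>f\<close>.\<close>

lemma projective_lift_exact:
  assumes Q: "projective C Q" and f: "f \<in> Mor C X Y" and g: "g \<in> Mor C Y Z"
    and ex: "exact_pair C f g" and h: "h \<in> Mor C Q Y" "g \<cdot> h = mzero C Q Z"
  obtains x where "x \<in> Mor C Q X" "f \<cdot> x = h"
proof -
  obtain c k where c: "is_cokernel C f c" and kc: "is_kernel C c k" and kg: "is_kernel C g k"
    using ex unfolding exact_pair_def is_image_def by blast
  have cM: "c \<in> Mor C Y (target C c)"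
    using cokernel_closed[OF c f] by simp
  have kM: "k \<in> Mor C (source C k) Y" and ck: "c \<cdot> k = mzero C (source C k) (target C c)"
    using kernel_closed[OF kc cM] by auto
  obtain v where v: "v \<in> Mor C Q (source C k)" "k \<cdot> v = h"
    using kernel_lift[OF kg g h] by metis
  have "c \<cdot> h = mzero C Q (target C c)"
    using cmp_assoc[OF v(1) kM cM] ck v(2) cmp_mzero_left[OF v(1)] Mor_Obj[OF cM] by simp
  then show thesis
    using projective_lift_cokernel[OF Q f c h(1)] that by metis
qed

end

text \<open>Indices are put in successor form, so that the facts compose with one another without
  side conditions \<open>n \<ge> 1\<close> or terms \<open>n - 1\<close>.\<close>

lemma augmented_complexD:
  assumes "augmented_complex C P d e X"
  shows "X \<in> Obj C" and "P n \<in> Obj C" and "e \<in> Mor C (P 0) X"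
    and "d (Suc n) \<in> Mor C (P (Suc n)) (P n)"
    and "e \<cdot>\<^bsub>C\<^esub> d (Suc 0) = mzero C (P (Suc 0)) X"
    and "d (Suc n) \<cdot>\<^bsub>C\<^esub> d (Suc (Suc n)) = mzero C (P (Suc (Suc n))) (P n)"
proof -
  have "\<forall>n\<ge>1. d n \<in> Mor C (P n) (P (n - 1))"
    and "\<forall>n\<ge>1. d n \<cdot>\<^bsub>C\<^esub> d (n + 1) = mzero C (P (n + 1)) (P (n - 1))"
    using assms unfolding augmented_complex_def by auto
  from this[THEN spec, of "Suc n"]
  show "d (Suc n) \<in> Mor C (P (Suc n)) (P n)"
    and "d (Suc n) \<cdot>\<^bsub>C\<^esub> d (Suc (Suc n)) = mzero C (P (Suc (Suc n))) (P n)"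
    by simp_all
qed (use assms in \<open>auto simp: augmented_complex_def\<close>)

section \<open>Splitting of exact complexes of projectives\<close>

context abelian_category
begin

text \<open>By \<open>g \<cdot> (s \<cdot> g) = g\<close>, the difference of the identity and
  \<open>s \<cdot> g\<close> is killed by \<open>g\<close>, so it lifts through \<open>f\<close> to
  some \<open>s'\<close>. Precomposing that difference with \<open>f\<close> gives back
  \<open>f\<close>, because \<open>g \<cdot> f\<close> is zero. This is the same splitting condition
  one degree higher.\<close>

lemma splitting_extend:
  assumes Q: "projective C Q" and f: "f \<in> Mor C X Q" and g: "g \<in> Mor C Q Z"
    and ex: "exact_pair C f g" and gf: "g \<cdot> f = mzero C X Z"
    and s: "s \<in> Mor C Z Q" "g \<cdot> (s \<cdot> g) = g"
  obtains s' where "s' \<in> Mor C Q X" "f \<cdot> s' = mdiff C (ident C Q) (s \<cdot> g)" "f \<cdot> (s' \<cdot> f) = f"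
proof -
  have idQ: "ident C Q \<in> Mor C Q Q"
    using ident_closed Mor_Obj[OF g] by simp
  have sg: "s \<cdot> g \<in> Mor C Q Q"
    using cmp_closed[OF g s(1)] .
  have "g \<cdot> mdiff C (ident C Q) (s \<cdot> g) = mzero C Q Z"
    unfolding cmp_mdiff_right[OF idQ sg g] s(2) cmp_ident_right[OF g] by (rule mdiff_self[OF g])
  then obtain s' where s': "s' \<in> Mor C Q X" "f \<cdot> s' = mdiff C (ident C Q) (s \<cdot> g)"
    using projective_lift_exact[OF Q f g ex mdiff_closed[OF idQ sg]] by metis
  have "(s \<cdot> g) \<cdot> f = mzero C X Q"
    using cmp_assoc[OF f g s(1)] gf cmp_mzero_right[OF s(1)] Mor_Obj[OF f] by simp
  then have "mdiff C (ident C Q) (s \<cdot> g) \<cdot> f = f"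
    using cmp_mdiff_left[OF f idQ sg] cmp_ident_left[OF f] mdiff_mzero[OF f] by simp
  then have "f \<cdot> (s' \<cdot> f) = f"
    using cmp_assoc[OF f s'(1) f] s'(2) by simp
  then show thesis
    using that s' by blast
qed

lemma exact_projective_complex_split:
  assumes cx: "augmented_complex C P d e X" and ex: "augmented_exact C d e X"
    and X: "projective C X" and P: "\<And>n. projective C (P n)"
  shows "\<exists>s \<in> Mor C (P n) (P (Suc n)). d (Suc n) \<cdot> (s \<cdot> d (Suc n)) = d (Suc n)"
proof (induction n)
  note D = augmented_complexD[OF cx]
  case 0
  have z: "mzero C X (zero_object C) \<in> Mor C X (zero_object C)"
    using mzero_closed D(1) zero_object_Obj by blast
  have exX: "exact_pair C e (mzero C X (zero_object C))" and ex0: "exact_pair C (d (Suc 0)) e"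
    using ex unfolding augmented_exact_def by auto
  \<comment> \<open>The splitting starts at the augmentation: every arrow into \<open>X\<close> is
    killed by the zero arrow out of it, so exactness at \<open>X\<close> lifts the identity through
    \<open>e\<close>.\<close>
  obtain t where t: "t \<in> Mor C X (P 0)" "e \<cdot> t = ident C X"
    using projective_lift_exact[OF X D(3) z exX ident_closed[OF D(1)] cmp_ident_right[OF z]] by metis
  have "e \<cdot> (t \<cdot> e) = e"
    using cmp_assoc[OF D(3) t(1) D(3)] t(2) cmp_ident_left[OF D(3)] by simp
  then show ?case
    using splitting_extend[OF P D(4) D(3) ex0 D(5) t(1)] by metis
next
  note D = augmented_complexD[OF cx]
  case (Suc n)
  have "exact_pair C (d (Suc (Suc n))) (d (Suc n))"
    using ex unfolding augmented_exact_def by auto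
  then show ?case
    using splitting_extend[OF P D(4) D(4) _ D(6)] Suc.IH by metis
qed

text \<open>The splittings write the identity of \<open>P (Suc n)\<close> as the sum of
  \<open>s \<cdot> d (Suc n)\<close> and \<open>d (Suc (Suc n)) \<cdot> s'\<close>. Applying
  \<open>g\<close> kills the second summand, so \<open>g \<cdot> s\<close> is the required
  arrow.\<close>

lemma exact_projective_complex_hom_exact:
  assumes cx: "augmented_complex C P d e X" and ex: "augmented_exact C d e X"
    and X: "projective C X" and P: "\<And>n. projective C (P n)"
    and g: "g \<in> Mor C (P (Suc n)) W" "g \<cdot> d (Suc (Suc n)) = mzero C (P (Suc (Suc n))) W"
  obtains h where "h \<in> Mor C (P n) W" "h \<cdot> d (Suc n) = g"
proof -
  note D = augmented_complexD[OF cx]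
  let ?Q = "P (Suc n)"
  have ex': "exact_pair C (d (Suc (Suc n))) (d (Suc n))"
    using ex unfolding augmented_exact_def by auto
  obtain s where s: "s \<in> Mor C (P n) ?Q" "d (Suc n) \<cdot> (s \<cdot> d (Suc n)) = d (Suc n)"
    using exact_projective_complex_split[OF cx ex X P] by metis
  obtain s' where s': "s' \<in> Mor C ?Q (P (Suc (Suc n)))"
      "d (Suc (Suc n)) \<cdot> s' = mdiff C (ident C ?Q) (s \<cdot> d (Suc n))"
    using splitting_extend[OF P D(4) D(4) ex' D(6) s] by metis
  have idQ: "ident C ?Q \<in> Mor C ?Q ?Q"
    using ident_closed D(2) .
  have sd: "s \<cdot> d (Suc n) \<in> Mor C ?Q ?Q"
    using cmp_closed[OF D(4) s(1)] .
  have gs: "g \<cdot> s \<in> Mor C (P n) W"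
    using cmp_closed[OF s(1) g(1)] .
  have "mdiff C g (g \<cdot> (s \<cdot> d (Suc n))) = g \<cdot> (d (Suc (Suc n)) \<cdot> s')"
    using cmp_mdiff_right[OF idQ sd g(1)] cmp_ident_right[OF g(1)] s'(2) by simp
  also have "\<dots> = mzero C ?Q W"
    using cmp_assoc[OF s'(1) D(4) g(1)] g(2) cmp_mzero_left[OF s'(1)] Mor_Obj[OF g(1)] by simp
  finally have "g = g \<cdot> (s \<cdot> d (Suc n))"
    by (rule mdiff_eq_mzeroD[OF g(1) cmp_closed[OF sd g(1)]])
  then have "(g \<cdot> s) \<cdot> d (Suc n) = g"
    using cmp_assoc[OF D(4) s(1) g(1)] by simp
  then show thesis
    using that gs by blast
qed

end


section \<open>Adjunctions\<close>

context additive_functor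
begin

lemma amap_mzero:
  assumes "X \<in> Obj C" and "Y \<in> Obj C"
  shows "amap F (mzero C X Y) = mzero D (omap F X) (omap F Y)"
proof -
  have "comm_group (Mor_group C X Y)" "comm_group (Mor_group D (omap F X) (omap F Y))"
    using assms C.Mor_comm_group D.Mor_comm_group omap_closed by auto
  then show ?thesis
    using hom_one[OF amap_additive[OF assms]] unfolding comm_group_def Mor_group_def by simp
qed

lemma augmented_complex_amap:
  assumes cx: "augmented_complex C P d e X"
  shows "augmented_complex D (\<lambda>n. omap F (P n)) (\<lambda>n. amap F (d n)) (amap F e) (omap F X)"
proof -
  note D = augmented_complexD[OF cx]
  have "amap F (d n) \<in> Mor D (omap F (P n)) (omap F (P (n - 1)))" if "n \<ge> 1" for n
    using amap_closed[OF D(4)[of "n - 1"]] that by simp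
  moreover have "amap F (d n) \<cdot>\<^bsub>D\<^esub> amap F (d (n + 1)) = mzero D (omap F (P (n + 1))) (omap F (P (n - 1)))"
    if n: "n \<ge> 1" for n
  proof -
    obtain m where "n = Suc m"
      using n by (cases n) auto
    then show ?thesis
      using amap_cmp[OF D(4)[of "Suc m"] D(4)[of m]] D(6)[of m] amap_mzero[OF D(2) D(2)] by simp
  qed
  ultimately show ?thesis
    using amap_cmp[OF D(4)[of 0] D(3)] D(5) amap_mzero[OF D(2) D(1)] amap_closed[OF D(3)]
    unfolding augmented_complex_def by (simp add: omap_closed D(1,2))
qed

end

section \<open>Transposition along an adjunction\<close>

context adjunction
begin

text \<open>The transpose from \<open>Mor A Q (omap R W)\<close> to
  \<open>Mor B (omap L Q) W\<close>. The object \<open>W\<close> is an argument, as it cannot be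
  read off from \<open>omap R W\<close> in general; \<open>sharp\<close>, the inverse bijection,
  takes \<open>Q\<close> for the same reason.\<close>

definition flat :: "'o2 \<Rightarrow> 'm1 \<Rightarrow> 'm2" where
  "flat W h = \<epsilon> W \<cdot>\<^bsub>B\<^esub> amap L h"

definition sharp :: "'o1 \<Rightarrow> 'm2 \<Rightarrow> 'm1" where
  "sharp Q g = amap R g \<cdot>\<^bsub>A\<^esub> \<eta> Q"

lemma flat_closed:
  assumes "h \<in> Mor A Q (omap R W)" and "W \<in> Obj B"
  shows "flat W h \<in> Mor B (omap L Q) W"
  unfolding flat_def
  using L.D.cmp_closed[OF L.amap_closed[OF assms(1)] counit_closed[OF assms(2)]] .

lemma sharp_closed:
  assumes "g \<in> Mor B (omap L Q) W" and "Q \<in> Obj A"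
  shows "sharp Q g \<in> Mor A Q (omap R W)"
  unfolding sharp_def
  using L.C.cmp_closed[OF unit_closed[OF assms(2)] R.amap_closed[OF assms(1)]] .

text \<open>Naturality of the counit moves \<open>g\<close> to the outside; the left triangle
  identity removes the rest. The other round trip uses the unit and the right triangle
  identity.\<close>

lemma flat_sharp:
  assumes g: "g \<in> Mor B (omap L Q) W" and Q: "Q \<in> Obj A"
  shows "flat W (sharp Q g) = g"
proof -
  have W: "W \<in> Obj B" and LQ: "omap L Q \<in> Obj B"
    using L.D.Mor_Obj[OF g] by auto
  note \<eta> = unit_closed[OF Q]
  have "flat W (sharp Q g) = \<epsilon> W \<cdot>\<^bsub>B\<^esub> (amap L (amap R g) \<cdot>\<^bsub>B\<^esub> amap L (\<eta> Q))"
    unfolding flat_def sharp_def using L.amap_cmp[OF \<eta> R.amap_closed[OF g]] by simp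
  also have "\<dots> = (g \<cdot>\<^bsub>B\<^esub> \<epsilon> (omap L Q)) \<cdot>\<^bsub>B\<^esub> amap L (\<eta> Q)"
    using L.D.cmp_assoc[OF L.amap_closed[OF \<eta>] L.amap_closed[OF R.amap_closed[OF g]] counit_closed[OF W]]
      counit_natural[OF g] by simp
  also have "\<dots> = g"
    using L.D.cmp_assoc[OF L.amap_closed[OF \<eta>] counit_closed[OF LQ] g] triangle_left[OF Q]
      L.D.cmp_ident_right[OF g] by simp
  finally show ?thesis .
qed

lemma sharp_flat:
  assumes h: "h \<in> Mor A Q (omap R W)" and W: "W \<in> Obj B"
  shows "sharp Q (flat W h) = h"
proof -
  have Q: "Q \<in> Obj A" and RW: "omap R W \<in> Obj A"
    using L.C.Mor_Obj[OF h] by auto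
  note \<epsilon> = counit_closed[OF W]
  have "sharp Q (flat W h) = (amap R (\<epsilon> W) \<cdot>\<^bsub>A\<^esub> amap R (amap L h)) \<cdot>\<^bsub>A\<^esub> \<eta> Q"
    unfolding flat_def sharp_def using R.amap_cmp[OF L.amap_closed[OF h] \<epsilon>] by simp
  also have "\<dots> = amap R (\<epsilon> W) \<cdot>\<^bsub>A\<^esub> (\<eta> (omap R W) \<cdot>\<^bsub>A\<^esub> h)"
    using L.C.cmp_assoc[OF unit_closed[OF Q] R.amap_closed[OF L.amap_closed[OF h]] R.amap_closed[OF \<epsilon>]]
      unit_natural[OF h] by simp
  also have "\<dots> = h"
    using L.C.cmp_assoc[OF h unit_closed[OF RW] R.amap_closed[OF \<epsilon>]] triangle_right[OF W]
      L.C.cmp_ident_left[OF h] by simp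
  finally show ?thesis .
qed

lemma flat_cmp_source:
  assumes p: "p \<in> Mor A Q' Q" and h: "h \<in> Mor A Q (omap R W)" and W: "W \<in> Obj B"
  shows "flat W (h \<cdot>\<^bsub>A\<^esub> p) = flat W h \<cdot>\<^bsub>B\<^esub> amap L p"
  unfolding flat_def
  using L.amap_cmp[OF p h] L.D.cmp_assoc[OF L.amap_closed[OF p] L.amap_closed[OF h] counit_closed[OF W]]
  by simp

lemma flat_cmp_target:
  assumes h: "h \<in> Mor A Q (omap R W)" and p: "p \<in> Mor B W W'"
  shows "flat W' (amap R p \<cdot>\<^bsub>A\<^esub> h) = p \<cdot>\<^bsub>B\<^esub> flat W h"
proof -
  have W: "W \<in> Obj B" and W': "W' \<in> Obj B"
    using L.D.Mor_Obj[OF p] by auto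
  show ?thesis
    unfolding flat_def
    using L.amap_cmp[OF h R.amap_closed[OF p]] counit_natural[OF p]
      L.D.cmp_assoc[OF L.amap_closed[OF h] L.amap_closed[OF R.amap_closed[OF p]] counit_closed[OF W']]
      L.D.cmp_assoc[OF L.amap_closed[OF h] counit_closed[OF W] p]
    by simp
qed

text \<open>Follows from the corresponding law for \<open>flat\<close>, because the two
  transpositions are mutually inverse.\<close>

lemma sharp_cmp_source:
  assumes p: "p \<in> Mor A Q' Q" and g: "g \<in> Mor B (omap L Q) W"
  shows "sharp Q' (g \<cdot>\<^bsub>B\<^esub> amap L p) = sharp Q g \<cdot>\<^bsub>A\<^esub> p"
proof -
  have Q: "Q \<in> Obj A" and W: "W \<in> Obj B"
    using L.C.Mor_Obj[OF p] L.D.Mor_Obj[OF g] by auto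
  have "g \<cdot>\<^bsub>B\<^esub> amap L p = flat W (sharp Q g \<cdot>\<^bsub>A\<^esub> p)"
    using flat_cmp_source[OF p sharp_closed[OF g Q] W] flat_sharp[OF g Q] by simp
  then show ?thesis
    using sharp_flat[OF L.C.cmp_closed[OF p sharp_closed[OF g Q]] W] by simp
qed

lemma flat_mzero:
  assumes "Q \<in> Obj A" and "W \<in> Obj B"
  shows "flat W (mzero A Q (omap R W)) = mzero B (omap L Q) W"
  unfolding flat_def
  using L.amap_mzero assms R.omap_closed L.omap_closed L.D.cmp_mzero_right[OF counit_closed] by simp

text \<open>Transposing turns a lifting problem along \<open>p\<close> in \<open>B\<close> into one
  along \<open>amap R p\<close> in \<open>A\<close>, where \<open>Q\<close> is projective; the
  solution is transposed back.\<close>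

lemma projective_left_adjoint:
  assumes epi: "\<And>p. is_epi B p \<Longrightarrow> is_epi A (amap R p)" and Q: "projective A Q"
  shows "projective B (omap L Q)"
  unfolding projective_def
proof (intro conjI allI impI ballI)
  have QO: "Q \<in> Obj A"
    using Q unfolding projective_def by simp
  then show "omap L Q \<in> Obj B"
    by (rule L.omap_closed)
  fix p g assume p: "is_epi B p" and g: "g \<in> Mor B (omap L Q) (target B p)"
  have pM: "p \<in> Mor B (source B p) (target B p)"
    using p unfolding is_epi_def Mor_def by simp
  have W: "source B p \<in> Obj B"
    using L.D.Mor_Obj[OF pM] by simp
  obtain h where h: "h \<in> Mor A Q (omap R (source B p))" "amap R p \<cdot>\<^bsub>A\<^esub> h = sharp Q g"
    using L.C.projective_lift[OF Q epi[OF p] R.amap_closed[OF pM] sharp_closed[OF g QO]] by metis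
  have "p \<cdot>\<^bsub>B\<^esub> flat (source B p) h = g"
    using flat_cmp_target[OF h(1) pM] h(2) flat_sharp[OF g QO] by simp
  then show "\<exists>h \<in> Mor B (omap L Q) (source B p). p \<cdot>\<^bsub>B\<^esub> h = g"
    using flat_closed[OF h(1) W] by blast
qed

end

text \<open>Arrows into \<open>omap \<theta>\<^sub>u W\<close> correspond to arrows in
  \<open>B\<close> out of the image complex under \<open>\<theta>\<^sub>l\<close>. That complex is
  exact and consists of projectives, hence splits, and the preimage found there is transposed back
  to \<open>A\<close>.\<close>

lemma (in omega_system) hom_exact:
  assumes X: "projective B X" and cx: "augmented_complex A P d e (omap \<theta>\<^sub>u X)"
    and P: "\<And>n. projective A (P n)"
    and ex: "augmented_exact B (\<lambda>n. amap \<theta>\<^sub>l (d n)) (amap \<theta>\<^sub>l e) (omap \<theta>\<^sub>l (omap \<theta>\<^sub>u X))"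
    and W: "W \<in> Obj B" and g: "g \<in> Mor A (P (Suc n)) (omap \<theta>\<^sub>u W)"
      "g \<cdot>\<^bsub>A\<^esub> d (Suc (Suc n)) = mzero A (P (Suc (Suc n))) (omap \<theta>\<^sub>u W)"
  obtains h where "h \<in> Mor A (P n) (omap \<theta>\<^sub>u W)" "h \<cdot>\<^bsub>A\<^esub> d (Suc n) = g"
proof -
  note D = augmented_complexD[OF cx]
  obtain \<eta> \<epsilon> where adj: "adjunction A B \<theta>\<^sub>l \<theta>\<^sub>u \<eta> \<epsilon>" and iso: "\<forall>Y \<in> Obj B. is_iso B (\<epsilon> Y)"
    using OP1_OP2 by blast
  interpret adjunction A B \<theta>\<^sub>l \<theta>\<^sub>u \<eta> \<epsilon>
    by (fact adj)
  have XO: "X \<in> Obj B"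
    using X unfolding projective_def by simp
  \<comment> \<open>The augmentation target is projective too: the counit identifies it with
    \<open>X\<close>.\<close>
  have LRX: "projective B (omap \<theta>\<^sub>l (omap \<theta>\<^sub>u X))"
    using B.projective_iso[OF _ counit_closed[OF XO] X] iso XO by blast
  have LP: "projective B (omap \<theta>\<^sub>l (P n))" for n
    using projective_left_adjoint[OF OP3 P] by blast
  have "flat W g \<cdot>\<^bsub>B\<^esub> amap \<theta>\<^sub>l (d (Suc (Suc n))) = mzero B (omap \<theta>\<^sub>l (P (Suc (Suc n)))) W"
    using flat_cmp_source[OF D(4) g(1) W] g(2) flat_mzero[OF D(2) W] by simp
  then obtain h where h: "h \<in> Mor B (omap \<theta>\<^sub>l (P n)) W" "h \<cdot>\<^bsub>B\<^esub> amap \<theta>\<^sub>l (d (Suc n)) = flat W g"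
    using B.exact_projective_complex_hom_exact[OF lower.augmented_complex_amap[OF cx] ex LRX LP
        flat_closed[OF g(1) W]] by metis
  have "sharp (P n) h \<cdot>\<^bsub>A\<^esub> d (Suc n) = g"
    using sharp_cmp_source[OF D(4) h(1)] h(2) sharp_flat[OF g(1) W] by simp
  then show thesis
    using that sharp_closed[OF h(1) D(2)] by blast
qed


section \<open>Extension of chain maps and homotopies\<close>

context abelian_category
begin

text \<open>The condition on zeroth homology makes \<open>P 1 -> P 0 -> Z -> 0\<close> behave like
  an exact sequence for arrows out of a projective.\<close>

lemma H0_iso_lift:
  assumes cx: "augmented_complex C P d e Z" and H0: "induces_H0_iso C P d e Z"
    and Q: "projective C Q"
  shows "h \<in> Mor C Q Z \<Longrightarrow> \<exists>x \<in> Mor C Q (P 0). e \<cdot> x = h"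
    and "g \<in> Mor C Q (P 0) \<Longrightarrow> e \<cdot> g = mzero C Q Z \<Longrightarrow> \<exists>x \<in> Mor C Q (P (Suc 0)). d (Suc 0) \<cdot> x = g"
proof -
  note D = augmented_complexD[OF cx]
  obtain k q t where hom: "is_homology C P d 0 k q" and t: "t \<in> Mor C (target C q) Z" "is_iso C t"
    and tq: "t \<cdot> q = e \<cdot> k"
    using H0 unfolding induces_H0_iso_def by blast
  obtain u where k: "is_kernel C (mzero C (P 0) (zero_object C)) k"
    and u: "u \<in> Mor C (P (Suc 0)) (source C k)" "k \<cdot> u = d (Suc 0)" "is_cokernel C u q"
    using hom unfolding is_homology_def boundary_def by auto
  have z: "mzero C (P 0) (zero_object C) \<in> Mor C (P 0) (zero_object C)"
    using mzero_closed D(2) zero_object_Obj by blast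
  have kM: "k \<in> Mor C (source C k) (P 0)"
    using kernel_closed[OF k z] by simp
  have qM: "q \<in> Mor C (source C k) (target C q)"
    using cokernel_closed[OF u(3,1)] by simp
  show "\<exists>x \<in> Mor C Q (P 0). e \<cdot> x = h" if h: "h \<in> Mor C Q Z"
  proof -
    \<comment> \<open>The composite \<open>e \<cdot> k\<close> equals the epimorphism
      \<open>t \<cdot> q\<close>, so \<open>h\<close> is first lifted into the cycles.\<close>
    obtain x where x: "x \<in> Mor C Q (source C k)" "(t \<cdot> q) \<cdot> x = h"
      using projective_lift[OF Q iso_cmp_epi[OF t(2,1) cokernel_epi[OF u(3)] qM] cmp_closed[OF qM t(1)] h]
      by metis
    then have "e \<cdot> (k \<cdot> x) = h"
      using cmp_assoc[OF x(1) kM D(3)] tq by simp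
    then show ?thesis
      using cmp_closed[OF x(1) kM] by blast
  qed
  show "\<exists>x \<in> Mor C Q (P (Suc 0)). d (Suc 0) \<cdot> x = g"
    if g: "g \<in> Mor C Q (P 0)" "e \<cdot> g = mzero C Q Z"
  proof -
    \<comment> \<open>The boundary out of \<open>P 0\<close> is zero, so every arrow into
      \<open>P 0\<close> factors through the cycles. Its class \<open>q \<cdot> y\<close> vanishes
      because \<open>t\<close> is mono.\<close>
    obtain y where y: "y \<in> Mor C Q (source C k)" "k \<cdot> y = g"
      using kernel_lift[OF k z g(1) cmp_mzero_left[OF g(1) zero_object_Obj]] by metis
    have "t \<cdot> (q \<cdot> y) = mzero C Q Z"
      using cmp_assoc[OF y(1) qM t(1)] cmp_assoc[OF y(1) kM D(3)] tq y(2) g(2) by simp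
    then have "q \<cdot> y = mzero C Q (target C q)"
      using mono_cmp_eq_mzero[OF iso_mono[OF t(2,1)] t(1) cmp_closed[OF y(1) qM]] by simp
    then obtain x where x: "x \<in> Mor C Q (P (Suc 0))" "u \<cdot> x = y"
      using projective_lift_cokernel[OF Q u(1,3) y(1)] by metis
    have "d (Suc 0) \<cdot> x = g"
      using cmp_assoc[OF x(1) u(1) kM] u(2) x(2) y(2) by simp
    then show ?thesis
      using x(1) by blast
  qed
qed

end

section \<open>Obstructions with values in the homology of the second complex\<close>

locale omega_complexes = omega_system A B \<theta>\<^sub>l \<theta>\<^sub>u
  for A :: "('o1, 'm1, 'z1) addcat_scheme"
    and B :: "('o2, 'm2, 'z2) addcat_scheme"
    and \<theta>\<^sub>l :: "('o1, 'm1, 'o2, 'm2) cat_map"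
    and \<theta>\<^sub>u :: "('o2, 'm2, 'o1, 'm1) cat_map" +
  fixes X Y :: 'o2 and P P' :: "nat \<Rightarrow> 'o1" and d d' :: "nat \<Rightarrow> 'm1" and e e' :: 'm1
  assumes X_projective: "projective B X"
    and complex_P: "augmented_complex A P d e (omap \<theta>\<^sub>u X)"
    and complex_P': "augmented_complex A P' d' e' (omap \<theta>\<^sub>u Y)"
    and P_projective: "projective A (P n)"
    and exact_lower_P: "augmented_exact B (\<lambda>n. amap \<theta>\<^sub>l (d n)) (amap \<theta>\<^sub>l e) (omap \<theta>\<^sub>l (omap \<theta>\<^sub>u X))"
    and homology_P': "\<exists>W \<in> Obj B. homology_isomorphic A P' d' n (omap \<theta>\<^sub>u W)"
    and H0_P': "induces_H0_iso A P' d' e' (omap \<theta>\<^sub>u Y)"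
begin

lemmas D = augmented_complexD[OF complex_P]
lemmas D' = augmented_complexD[OF complex_P']

text \<open>The homology class of \<open>c\<close> is a cocycle with values in some
  \<open>omap \<theta>\<^sub>u W\<close>, since \<open>c \<cdot> d (Suc (Suc n))\<close> is a
  boundary, and is therefore a coboundary. Lifting the cobounding arrow to cycles gives
  \<open>s\<close>; what remains of \<open>c\<close> has class zero and lifts through the
  differential to \<open>g\<close>. The degrees \<open>n\<close> and \<open>m\<close> are
  independent, as chain maps need source degree one above target degree and homotopies need equal
  degrees.\<close>

lemma cocycle_decompose:
  assumes c: "c \<in> Mor A (P (Suc n)) (P' (Suc m))"
    and d'c: "d' (Suc m) \<cdot>\<^bsub>A\<^esub> c = mzero A (P (Suc n)) (P' m)"
    and x: "x \<in> Mor A (P (Suc (Suc n))) (P' (Suc (Suc m)))"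
      "c \<cdot>\<^bsub>A\<^esub> d (Suc (Suc n)) = d' (Suc (Suc m)) \<cdot>\<^bsub>A\<^esub> x"
  obtains s g where "s \<in> Mor A (P n) (P' (Suc m))" "g \<in> Mor A (P (Suc n)) (P' (Suc (Suc m)))"
    "d' (Suc m) \<cdot>\<^bsub>A\<^esub> s = mzero A (P n) (P' m)"
    "c = (s \<cdot>\<^bsub>A\<^esub> d (Suc n)) \<boxplus>\<^bsub>A\<^esub> (d' (Suc (Suc m)) \<cdot>\<^bsub>A\<^esub> g)"
proof -
  obtain W k q where W: "W \<in> Obj B" and hom: "is_homology A P' d' (Suc m) k q"
      and "isomorphic A (target A q) (omap \<theta>\<^sub>u W)"
    using homology_P' unfolding homology_isomorphic_def by blast
  then obtain t where t: "t \<in> Mor A (target A q) (omap \<theta>\<^sub>u W)" "is_iso A t"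
    unfolding isomorphic_def by blast
  define K where "K = source A k"
  obtain u where k: "is_kernel A (d' (Suc m)) k" and u: "u \<in> Mor A (P' (Suc (Suc m))) K"
      "k \<cdot>\<^bsub>A\<^esub> u = d' (Suc (Suc m))" and q: "is_cokernel A u q"
    using hom unfolding is_homology_def boundary_def K_def by auto
  have kM: "k \<in> Mor A K (P' (Suc m))" and d'k: "d' (Suc m) \<cdot>\<^bsub>A\<^esub> k = mzero A K (P' m)"
    using A.kernel_closed[OF k D'(4)] unfolding K_def by auto
  have qM: "q \<in> Mor A K (target A q)" and qu: "q \<cdot>\<^bsub>A\<^esub> u = mzero A (P' (Suc (Suc m))) (target A q)"
    using A.cokernel_closed[OF q u(1)] by auto
  \<comment> \<open>\<open>r\<close> sends a cycle to its homology class, seen in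
    \<open>omap \<theta>\<^sub>u W\<close>.\<close>
  define r where "r = t \<cdot>\<^bsub>A\<^esub> q"
  have rM: "r \<in> Mor A K (omap \<theta>\<^sub>u W)"
    using A.cmp_closed[OF qM t(1)] unfolding r_def .
  have ru: "r \<cdot>\<^bsub>A\<^esub> u = mzero A (P' (Suc (Suc m))) (omap \<theta>\<^sub>u W)"
    unfolding r_def using A.cmp_assoc[OF u(1) qM t(1)] qu A.cmp_mzero_right[OF t(1) D'(2)] by simp
  have r_epi: "is_epi A r"
    unfolding r_def using A.iso_cmp_epi[OF t(2,1) A.cokernel_epi[OF q] qM] .
  obtain z where z: "z \<in> Mor A (P (Suc n)) K" "k \<cdot>\<^bsub>A\<^esub> z = c"
    using A.kernel_lift[OF k D'(4) c d'c] unfolding K_def by metis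
  have "k \<cdot>\<^bsub>A\<^esub> (z \<cdot>\<^bsub>A\<^esub> d (Suc (Suc n))) = k \<cdot>\<^bsub>A\<^esub> (u \<cdot>\<^bsub>A\<^esub> x)"
    using A.cmp_assoc[OF D(4) z(1) kM] A.cmp_assoc[OF x(1) u(1) kM] z(2) u(2) x(2) by simp
  then have zd: "z \<cdot>\<^bsub>A\<^esub> d (Suc (Suc n)) = u \<cdot>\<^bsub>A\<^esub> x"
    using A.kernel_mono[OF k] A.cmp_closed[OF D(4) z(1)] A.cmp_closed[OF x(1) u(1)]
    unfolding A.mono_iff[OF kM] by blast
  have rz: "r \<cdot>\<^bsub>A\<^esub> z \<in> Mor A (P (Suc n)) (omap \<theta>\<^sub>u W)"
    using A.cmp_closed[OF z(1) rM] .
  have "(r \<cdot>\<^bsub>A\<^esub> z) \<cdot>\<^bsub>A\<^esub> d (Suc (Suc n)) = mzero A (P (Suc (Suc n))) (omap \<theta>\<^sub>u W)"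
    using A.cmp_assoc[OF D(4) z(1) rM] A.cmp_assoc[OF x(1) u(1) rM] zd ru
      A.cmp_mzero_left[OF x(1) upper.omap_closed[OF W]] by simp
  then obtain h where h: "h \<in> Mor A (P n) (omap \<theta>\<^sub>u W)" "h \<cdot>\<^bsub>A\<^esub> d (Suc n) = r \<cdot>\<^bsub>A\<^esub> z"
    using hom_exact[OF X_projective complex_P P_projective exact_lower_P W rz] by metis
  obtain y where y: "y \<in> Mor A (P n) K" "r \<cdot>\<^bsub>A\<^esub> y = h"
    using A.projective_lift[OF P_projective r_epi rM h(1)] by metis
  have yd: "y \<cdot>\<^bsub>A\<^esub> d (Suc n) \<in> Mor A (P (Suc n)) K"
    using A.cmp_closed[OF D(4) y(1)] .
  \<comment> \<open>Subtracting the lifted coboundary leaves an arrow \<open>w\<close> into the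
    cycles whose homology class is zero.\<close>
  define w where "w = mdiff A z (y \<cdot>\<^bsub>A\<^esub> d (Suc n))"
  have wM: "w \<in> Mor A (P (Suc n)) K"
    unfolding w_def using A.mdiff_closed[OF z(1) yd] .
  have "r \<cdot>\<^bsub>A\<^esub> w = mdiff A (r \<cdot>\<^bsub>A\<^esub> z) (r \<cdot>\<^bsub>A\<^esub> z)"
    unfolding w_def using A.cmp_mdiff_right[OF z(1) yd rM] A.cmp_assoc[OF D(4) y(1) rM] y(2) h(2) by simp
  then have "t \<cdot>\<^bsub>A\<^esub> (q \<cdot>\<^bsub>A\<^esub> w) = mzero A (P (Suc n)) (omap \<theta>\<^sub>u W)"
    using A.mdiff_self[OF rz] A.cmp_assoc[OF wM qM t(1)] unfolding r_def by simp
  then have "q \<cdot>\<^bsub>A\<^esub> w = mzero A (P (Suc n)) (target A q)"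
    using A.mono_cmp_eq_mzero[OF A.iso_mono[OF t(2,1)] t(1) A.cmp_closed[OF wM qM]] by simp
  then obtain g where g: "g \<in> Mor A (P (Suc n)) (P' (Suc (Suc m)))" "u \<cdot>\<^bsub>A\<^esub> g = w"
    using A.projective_lift_cokernel[OF P_projective u(1) q wM] by metis
  have kw: "k \<cdot>\<^bsub>A\<^esub> w = d' (Suc (Suc m)) \<cdot>\<^bsub>A\<^esub> g"
    using A.cmp_assoc[OF g(1) u(1) kM] u(2) g(2) by simp
  have "c = k \<cdot>\<^bsub>A\<^esub> ((y \<cdot>\<^bsub>A\<^esub> d (Suc n)) \<boxplus>\<^bsub>A\<^esub> w)"
    using z(2) A.mdiff_madd[OF z(1) yd] A.madd_commute[OF wM yd] unfolding w_def by simp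
  also have "\<dots> = ((k \<cdot>\<^bsub>A\<^esub> y) \<cdot>\<^bsub>A\<^esub> d (Suc n)) \<boxplus>\<^bsub>A\<^esub> (d' (Suc (Suc m)) \<cdot>\<^bsub>A\<^esub> g)"
    using A.cmp_madd_right[OF yd wM kM] A.cmp_assoc[OF D(4) y(1) kM] kw by simp
  finally have "c = ((k \<cdot>\<^bsub>A\<^esub> y) \<cdot>\<^bsub>A\<^esub> d (Suc n)) \<boxplus>\<^bsub>A\<^esub> (d' (Suc (Suc m)) \<cdot>\<^bsub>A\<^esub> g)" .
  moreover have "d' (Suc m) \<cdot>\<^bsub>A\<^esub> (k \<cdot>\<^bsub>A\<^esub> y) = mzero A (P n) (P' m)"
    using A.cmp_assoc[OF y(1) kM D'(4)] d'k A.cmp_mzero_left[OF y(1) D'(2)] by simp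
  ultimately show thesis
    using that A.cmp_closed[OF y(1) kM] g(1) by blast
qed

text \<open>The obstruction to continuing past the provisional component \<open>b\<close> is the
  class of \<open>b \<cdot> d (Suc (Suc n))\<close>. Replacing \<open>b\<close> by its difference
  with \<open>s\<close> removes it, and keeps the equation with \<open>a\<close> because the
  differential kills \<open>s\<close>.\<close>

lemma chain_map_extend:
  assumes a: "a \<in> Mor A (P n) (P' n)" and b: "b \<in> Mor A (P (Suc n)) (P' (Suc n))"
    and ab: "d' (Suc n) \<cdot>\<^bsub>A\<^esub> b = a \<cdot>\<^bsub>A\<^esub> d (Suc n)"
  obtains f g where "f \<in> Mor A (P (Suc n)) (P' (Suc n))"
    "g \<in> Mor A (P (Suc (Suc n))) (P' (Suc (Suc n)))"
    "d' (Suc n) \<cdot>\<^bsub>A\<^esub> f = a \<cdot>\<^bsub>A\<^esub> d (Suc n)"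
    "d' (Suc (Suc n)) \<cdot>\<^bsub>A\<^esub> g = f \<cdot>\<^bsub>A\<^esub> d (Suc (Suc n))"
proof -
  let ?c = "b \<cdot>\<^bsub>A\<^esub> d (Suc (Suc n))"
  \<comment> \<open>The zero arrow serves as \<open>x\<close> in the decomposition: two successive
    differentials compose to zero.\<close>
  let ?z = "mzero A (P (Suc (Suc (Suc n)))) (P' (Suc (Suc n)))"
  have c: "?c \<in> Mor A (P (Suc (Suc n))) (P' (Suc n))"
    using A.cmp_closed[OF D(4) b] .
  have "d' (Suc n) \<cdot>\<^bsub>A\<^esub> ?c = mzero A (P (Suc (Suc n))) (P' n)"
    using A.cmp_assoc[OF D(4) b D'(4)] A.cmp_assoc[OF D(4) D(4) a] ab D(6) A.cmp_mzero_right[OF a D(2)]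
    by simp
  moreover have "?z \<in> Mor A (P (Suc (Suc (Suc n)))) (P' (Suc (Suc n)))"
    using A.mzero_closed[OF D(2) D'(2)] .
  moreover have "?c \<cdot>\<^bsub>A\<^esub> d (Suc (Suc (Suc n))) = d' (Suc (Suc n)) \<cdot>\<^bsub>A\<^esub> ?z"
    using A.cmp_assoc[OF D(4) D(4) b] D(6) A.cmp_mzero_right[OF b D(2)] A.cmp_mzero_right[OF D'(4) D(2)]
    by simp
  ultimately obtain s g where s: "s \<in> Mor A (P (Suc n)) (P' (Suc n))"
      "d' (Suc n) \<cdot>\<^bsub>A\<^esub> s = mzero A (P (Suc n)) (P' n)"
    and g: "g \<in> Mor A (P (Suc (Suc n))) (P' (Suc (Suc n)))"
    and eq: "?c = (s \<cdot>\<^bsub>A\<^esub> d (Suc (Suc n))) \<boxplus>\<^bsub>A\<^esub> (d' (Suc (Suc n)) \<cdot>\<^bsub>A\<^esub> g)"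
    using cocycle_decompose[OF c] by metis
  have sd: "s \<cdot>\<^bsub>A\<^esub> d (Suc (Suc n)) \<in> Mor A (P (Suc (Suc n))) (P' (Suc n))"
    and d'g: "d' (Suc (Suc n)) \<cdot>\<^bsub>A\<^esub> g \<in> Mor A (P (Suc (Suc n))) (P' (Suc n))"
    using A.cmp_closed[OF D(4) s(1)] A.cmp_closed[OF g D'(4)] .
  have "d' (Suc n) \<cdot>\<^bsub>A\<^esub> mdiff A b s = a \<cdot>\<^bsub>A\<^esub> d (Suc n)"
    using A.cmp_mdiff_right[OF b s(1) D'(4)] ab s(2) A.mdiff_mzero[OF A.cmp_closed[OF D(4) a]] by simp
  moreover have "d' (Suc (Suc n)) \<cdot>\<^bsub>A\<^esub> g = mdiff A b s \<cdot>\<^bsub>A\<^esub> d (Suc (Suc n))"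
    using A.cmp_mdiff_left[OF D(4) b s(1)] eq A.madd_commute[OF sd d'g] A.madd_mdiff[OF d'g sd] by simp
  ultimately show thesis
    using that A.mdiff_closed[OF b s(1)] g by blast
qed

lemma ex_chain_map:
  assumes \<phi>: "\<phi> \<in> Mor A (omap \<theta>\<^sub>u X) (omap \<theta>\<^sub>u Y)"
  shows "\<exists>F. chain_map_over A P d e P' d' e' \<phi> F"
proof -
  \<comment> \<open>Besides the equation in degree zero, the invariant demands that the component
    extend by one more degree. The extension \<open>g\<close> is only provisional: the next step may
    correct it.\<close>
  define good where "good n a \<longleftrightarrow> a \<in> Mor A (P n) (P' n) \<and>
      (n = 0 \<longrightarrow> e' \<cdot>\<^bsub>A\<^esub> a = \<phi> \<cdot>\<^bsub>A\<^esub> e) \<and>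
      (\<exists>g \<in> Mor A (P (Suc n)) (P' (Suc n)). d' (Suc n) \<cdot>\<^bsub>A\<^esub> g = a \<cdot>\<^bsub>A\<^esub> d (Suc n))" for n a
  obtain a where a: "a \<in> Mor A (P 0) (P' 0)" "e' \<cdot>\<^bsub>A\<^esub> a = \<phi> \<cdot>\<^bsub>A\<^esub> e"
    using A.H0_iso_lift(1)[OF complex_P' H0_P' P_projective A.cmp_closed[OF D(3) \<phi>]] by blast
  \<comment> \<open>This vanishing lets \<open>a \<cdot> d (Suc 0)\<close> lift through
    \<open>d' (Suc 0)\<close>, which supplies the provisional component in degree one.\<close>
  have "e' \<cdot>\<^bsub>A\<^esub> (a \<cdot>\<^bsub>A\<^esub> d (Suc 0)) = mzero A (P (Suc 0)) (omap \<theta>\<^sub>u Y)"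
    using A.cmp_assoc[OF D(4) a(1) D'(3)] A.cmp_assoc[OF D(4) D(3) \<phi>] a(2) D(5) A.cmp_mzero_right[OF \<phi> D(2)]
    by simp
  then have "good 0 a"
    unfolding good_def
    using a A.H0_iso_lift(2)[OF complex_P' H0_P' P_projective A.cmp_closed[OF D(4) a(1)]] by blast
  moreover have "\<exists>b. good (Suc n) b \<and> d' (Suc n) \<cdot>\<^bsub>A\<^esub> b = a \<cdot>\<^bsub>A\<^esub> d (Suc n)" if "good n a" for n a
    using that chain_map_extend[of a n] unfolding good_def by (metis nat.distinct(1))
  ultimately obtain F where F: "\<And>n. good n (F n)"
      "\<And>n. d' (Suc n) \<cdot>\<^bsub>A\<^esub> F (Suc n) = F n \<cdot>\<^bsub>A\<^esub> d (Suc n)"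
    using dependent_nat_choice[of good "\<lambda>n a b. d' (Suc n) \<cdot>\<^bsub>A\<^esub> b = a \<cdot>\<^bsub>A\<^esub> d (Suc n)"] by metis
  have "d' n \<cdot>\<^bsub>A\<^esub> F n = F (n - 1) \<cdot>\<^bsub>A\<^esub> d n" if "n \<ge> 1" for n
    using that F(2)[of "n - 1"] by simp
  then have "chain_map_over A P d e P' d' e' \<phi> F"
    using F(1) unfolding chain_map_over_def good_def by blast
  then show ?thesis
    by blast
qed

text \<open>The error of \<open>u\<close> against \<open>b \<cdot> d (Suc n)\<close> is killed by
  the differential, and \<open>u'\<close> makes its composite with the next \<open>d\<close> a
  boundary. Decomposing it yields \<open>s\<close>, and adding \<open>s\<close> to \<open>b\<close>
  leaves the composite with \<open>d'\<close> unchanged.\<close>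

lemma null_homotopy_correct:
  assumes b: "b \<in> Mor A (P n) (P' (Suc n))"
    and u: "u \<in> Mor A (P (Suc n)) (P' (Suc n))" "u' \<in> Mor A (P (Suc (Suc n))) (P' (Suc (Suc n)))"
    and uu': "d' (Suc (Suc n)) \<cdot>\<^bsub>A\<^esub> u' = u \<cdot>\<^bsub>A\<^esub> d (Suc (Suc n))"
    and d'u: "d' (Suc n) \<cdot>\<^bsub>A\<^esub> u = (d' (Suc n) \<cdot>\<^bsub>A\<^esub> b) \<cdot>\<^bsub>A\<^esub> d (Suc n)"
  obtains h g where "h \<in> Mor A (P n) (P' (Suc n))" "g \<in> Mor A (P (Suc n)) (P' (Suc (Suc n)))"
    "d' (Suc n) \<cdot>\<^bsub>A\<^esub> h = d' (Suc n) \<cdot>\<^bsub>A\<^esub> b"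
    "u = (d' (Suc (Suc n)) \<cdot>\<^bsub>A\<^esub> g) \<boxplus>\<^bsub>A\<^esub> (h \<cdot>\<^bsub>A\<^esub> d (Suc n))"
proof -
  have bd: "b \<cdot>\<^bsub>A\<^esub> d (Suc n) \<in> Mor A (P (Suc n)) (P' (Suc n))"
    using A.cmp_closed[OF D(4) b] .
  define c where "c = mdiff A u (b \<cdot>\<^bsub>A\<^esub> d (Suc n))"
  have c: "c \<in> Mor A (P (Suc n)) (P' (Suc n))"
    unfolding c_def using A.mdiff_closed[OF u(1) bd] .
  have "d' (Suc n) \<cdot>\<^bsub>A\<^esub> c = mzero A (P (Suc n)) (P' n)"
    unfolding c_def using A.cmp_mdiff_right[OF u(1) bd D'(4)] d'u A.cmp_assoc[OF D(4) b D'(4)]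
      A.mdiff_self[OF A.cmp_closed[OF bd D'(4)]] by simp
  moreover have "c \<cdot>\<^bsub>A\<^esub> d (Suc (Suc n)) = d' (Suc (Suc n)) \<cdot>\<^bsub>A\<^esub> u'"
    unfolding c_def using A.cmp_mdiff_left[OF D(4) u(1) bd] A.cmp_assoc[OF D(4) D(4) b] D(6)
      A.cmp_mzero_right[OF b D(2)] A.mdiff_mzero[OF A.cmp_closed[OF D(4) u(1)]] uu' by simp
  ultimately obtain s g where s: "s \<in> Mor A (P n) (P' (Suc n))"
      "d' (Suc n) \<cdot>\<^bsub>A\<^esub> s = mzero A (P n) (P' n)"
    and g: "g \<in> Mor A (P (Suc n)) (P' (Suc (Suc n)))"
    and eq: "c = (s \<cdot>\<^bsub>A\<^esub> d (Suc n)) \<boxplus>\<^bsub>A\<^esub> (d' (Suc (Suc n)) \<cdot>\<^bsub>A\<^esub> g)"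
    using cocycle_decompose[OF c _ u(2)] by metis
  have sd: "s \<cdot>\<^bsub>A\<^esub> d (Suc n) \<in> Mor A (P (Suc n)) (P' (Suc n))"
    and d'g: "d' (Suc (Suc n)) \<cdot>\<^bsub>A\<^esub> g \<in> Mor A (P (Suc n)) (P' (Suc n))"
    using A.cmp_closed[OF D(4) s(1)] A.cmp_closed[OF g D'(4)] .
  have "d' (Suc n) \<cdot>\<^bsub>A\<^esub> (s \<boxplus>\<^bsub>A\<^esub> b) = d' (Suc n) \<cdot>\<^bsub>A\<^esub> b"
    using A.cmp_madd_right[OF s(1) b D'(4)] s(2) A.madd_mzero_left[OF A.cmp_closed[OF b D'(4)]] by simp
  moreover have "u = (d' (Suc (Suc n)) \<cdot>\<^bsub>A\<^esub> g) \<boxplus>\<^bsub>A\<^esub> ((s \<boxplus>\<^bsub>A\<^esub> b) \<cdot>\<^bsub>A\<^esub> d (Suc n))"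
    using A.mdiff_madd[OF u(1) bd] eq A.madd_commute[OF sd d'g] A.madd_assoc[OF d'g sd bd]
      A.cmp_madd_left[OF D(4) s(1) b] unfolding c_def by simp
  ultimately show thesis
    using that A.madd_closed[OF s(1) b] g by blast
qed

text \<open>\<open>u 0\<close> lifts through \<open>d' (Suc 0)\<close> by the condition on zeroth
  homology. From then on each component is corrected by an arrow into the cycles, so that a next one
  exists.\<close>

lemma ex_null_homotopy:
  assumes u: "\<And>n. u n \<in> Mor A (P n) (P' n)"
    and e'u: "e' \<cdot>\<^bsub>A\<^esub> u 0 = mzero A (P 0) (omap \<theta>\<^sub>u Y)"
    and d'u: "\<And>n. d' (Suc n) \<cdot>\<^bsub>A\<^esub> u (Suc n) = u n \<cdot>\<^bsub>A\<^esub> d (Suc n)"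
  obtains h where "\<And>n. h n \<in> Mor A (P n) (P' (Suc n))" "u 0 = d' (Suc 0) \<cdot>\<^bsub>A\<^esub> h 0"
    "\<And>n. u (Suc n) = (d' (Suc (Suc n)) \<cdot>\<^bsub>A\<^esub> h (Suc n)) \<boxplus>\<^bsub>A\<^esub> (h n \<cdot>\<^bsub>A\<^esub> d (Suc n))"
proof -
  define good where "good n a \<longleftrightarrow> a \<in> Mor A (P n) (P' (Suc n)) \<and>
      (n = 0 \<longrightarrow> u 0 = d' (Suc 0) \<cdot>\<^bsub>A\<^esub> a) \<and>
      (\<exists>g \<in> Mor A (P (Suc n)) (P' (Suc (Suc n))).
         u (Suc n) = (d' (Suc (Suc n)) \<cdot>\<^bsub>A\<^esub> g) \<boxplus>\<^bsub>A\<^esub> (a \<cdot>\<^bsub>A\<^esub> d (Suc n)))" for n a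
  define Q where "Q n a b \<longleftrightarrow>
      u (Suc n) = (d' (Suc (Suc n)) \<cdot>\<^bsub>A\<^esub> b) \<boxplus>\<^bsub>A\<^esub> (a \<cdot>\<^bsub>A\<^esub> d (Suc n))" for n a b
  obtain b where b: "b \<in> Mor A (P 0) (P' (Suc 0))" "d' (Suc 0) \<cdot>\<^bsub>A\<^esub> b = u 0"
    using A.H0_iso_lift(2)[OF complex_P' H0_P' P_projective u e'u] by blast
  have "d' (Suc 0) \<cdot>\<^bsub>A\<^esub> u (Suc 0) = (d' (Suc 0) \<cdot>\<^bsub>A\<^esub> b) \<cdot>\<^bsub>A\<^esub> d (Suc 0)"
    using d'u b(2) by simp
  from null_homotopy_correct[OF b(1) u u d'u this] have "\<exists>a. good 0 a"
    unfolding good_def b(2) by metis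
  moreover have "\<exists>b. good (Suc n) b \<and> Q n a b" if "good n a" for n a
  proof -
    obtain b where a: "a \<in> Mor A (P n) (P' (Suc n))" and b: "b \<in> Mor A (P (Suc n)) (P' (Suc (Suc n)))"
        "Q n a b"
      using \<open>good n a\<close> unfolding good_def Q_def by blast
    have ad: "a \<cdot>\<^bsub>A\<^esub> d (Suc n) \<in> Mor A (P (Suc n)) (P' (Suc n))"
      and d'b: "d' (Suc (Suc n)) \<cdot>\<^bsub>A\<^esub> b \<in> Mor A (P (Suc n)) (P' (Suc n))"
      using A.cmp_closed[OF D(4) a] A.cmp_closed[OF b(1) D'(4)] .
    have "(a \<cdot>\<^bsub>A\<^esub> d (Suc n)) \<cdot>\<^bsub>A\<^esub> d (Suc (Suc n)) = mzero A (P (Suc (Suc n))) (P' (Suc n))"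
      using A.cmp_assoc[OF D(4) D(4) a] D(6) A.cmp_mzero_right[OF a D(2)] by simp
    \<comment> \<open>The summand \<open>a \<cdot> d (Suc n)\<close> vanishes after one more
      differential, so the provisional \<open>b\<close> meets the requirement for being
      corrected.\<close>
    then have "u (Suc n) \<cdot>\<^bsub>A\<^esub> d (Suc (Suc n)) = (d' (Suc (Suc n)) \<cdot>\<^bsub>A\<^esub> b) \<cdot>\<^bsub>A\<^esub> d (Suc (Suc n))"
      using b(2) A.cmp_madd_left[OF D(4) d'b ad] A.madd_mzero_right[OF A.cmp_closed[OF D(4) d'b]]
      unfolding Q_def by simp
    then have "d' (Suc (Suc n)) \<cdot>\<^bsub>A\<^esub> u (Suc (Suc n)) = (d' (Suc (Suc n)) \<cdot>\<^bsub>A\<^esub> b) \<cdot>\<^bsub>A\<^esub> d (Suc (Suc n))"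
      using d'u by simp
    from null_homotopy_correct[OF b(1) u u d'u this]
    obtain h g where "h \<in> Mor A (P (Suc n)) (P' (Suc (Suc n)))"
      "g \<in> Mor A (P (Suc (Suc n))) (P' (Suc (Suc (Suc n))))"
      "d' (Suc (Suc n)) \<cdot>\<^bsub>A\<^esub> h = d' (Suc (Suc n)) \<cdot>\<^bsub>A\<^esub> b"
      "u (Suc (Suc n)) = (d' (Suc (Suc (Suc n))) \<cdot>\<^bsub>A\<^esub> g) \<boxplus>\<^bsub>A\<^esub> (h \<cdot>\<^bsub>A\<^esub> d (Suc (Suc n)))"
      by blast
    \<comment> \<open>\<open>Q\<close> depends on its last argument only through the composite with
      \<open>d'\<close>, which is the same for \<open>h\<close> and \<open>b\<close>.\<close>
    then have "good (Suc n) h \<and> Q n a h"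
      using b(2) unfolding good_def Q_def by auto
    then show ?thesis ..
  qed
  ultimately obtain h where "\<And>n. good n (h n)" "\<And>n. Q n (h n) (h (Suc n))"
    using dependent_nat_choice[of good Q] by metis
  then show thesis
    using that[of h] unfolding good_def Q_def by blast
qed

text \<open>The difference of two chain maps over the same \<open>\<phi>\<close> is a chain map over
  zero, and a null homotopy of it is a homotopy between them.\<close>

lemma chain_map_unique:
  assumes \<phi>: "\<phi> \<in> Mor A (omap \<theta>\<^sub>u X) (omap \<theta>\<^sub>u Y)"
    and "chain_map_over A P d e P' d' e' \<phi> F" and "chain_map_over A P d e P' d' e' \<phi> G"
  shows "chain_homotopic A P d P' d' F G"
proof -
  have F: "F n \<in> Mor A (P n) (P' n)" "d' (Suc n) \<cdot>\<^bsub>A\<^esub> F (Suc n) = F n \<cdot>\<^bsub>A\<^esub> d (Suc n)"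
    and G: "G n \<in> Mor A (P n) (P' n)" "d' (Suc n) \<cdot>\<^bsub>A\<^esub> G (Suc n) = G n \<cdot>\<^bsub>A\<^esub> d (Suc n)"
    and e': "e' \<cdot>\<^bsub>A\<^esub> F 0 = \<phi> \<cdot>\<^bsub>A\<^esub> e" "e' \<cdot>\<^bsub>A\<^esub> G 0 = \<phi> \<cdot>\<^bsub>A\<^esub> e" for n
    using assms(2,3) unfolding chain_map_over_def by (auto dest: spec[of _ "Suc n"])
  define u where "u n = mdiff A (F n) (G n)" for n
  have "u n \<in> Mor A (P n) (P' n)" for n
    unfolding u_def using A.mdiff_closed[OF F(1) G(1)] .
  moreover have "e' \<cdot>\<^bsub>A\<^esub> u 0 = mzero A (P 0) (omap \<theta>\<^sub>u Y)"
    unfolding u_def using A.cmp_mdiff_right[OF F(1) G(1) D'(3)] e' A.mdiff_self[OF A.cmp_closed[OF D(3) \<phi>]]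
    by simp
  moreover have "d' (Suc n) \<cdot>\<^bsub>A\<^esub> u (Suc n) = u n \<cdot>\<^bsub>A\<^esub> d (Suc n)" for n
    unfolding u_def using A.cmp_mdiff_right[OF F(1) G(1) D'(4)] A.cmp_mdiff_left[OF D(4) F(1) G(1)] F(2) G(2)
    by simp
  ultimately obtain h where h: "\<And>n. h n \<in> Mor A (P n) (P' (Suc n))" "u 0 = d' (Suc 0) \<cdot>\<^bsub>A\<^esub> h 0"
      "\<And>n. u (Suc n) = (d' (Suc (Suc n)) \<cdot>\<^bsub>A\<^esub> h (Suc n)) \<boxplus>\<^bsub>A\<^esub> (h n \<cdot>\<^bsub>A\<^esub> d (Suc n))"
    using ex_null_homotopy[of u] by metis
  have "u n = (d' (n + 1) \<cdot>\<^bsub>A\<^esub> h n) \<boxplus>\<^bsub>A\<^esub> (h (n - 1) \<cdot>\<^bsub>A\<^esub> d n)" if "n \<ge> 1" for n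
    using h(3)[of "n - 1"] that by simp
  then show ?thesis
    using h(1,2) unfolding chain_homotopic_def u_def by auto
qed

end

section \<open>The comparison theorem for morphisms coming from \<open>B\<close>\<close>

theorem proposition1p7:
  fixes A :: "('o1, 'm1, 'z1) addcat_scheme"
    and B :: "('o2, 'm2, 'z2) addcat_scheme"
    and \<theta>\<^sub>l :: "('o1, 'm1, 'o2, 'm2) cat_map"
    and \<theta>\<^sub>u :: "('o2, 'm2, 'o1, 'm1) cat_map"
    and X Y :: 'o2 and f :: 'm2
    and P P' :: "nat \<Rightarrow> 'o1" and d d' :: "nat \<Rightarrow> 'm1" and e e' :: 'm1
  assumes "omega_system A B \<theta>\<^sub>l \<theta>\<^sub>u"
    and "projective B X" and "projective B Y" and "f \<in> Mor B X Y"
    and "augmented_complex A P d e (omap \<theta>\<^sub>u X)"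
    and "augmented_complex A P' d' e' (omap \<theta>\<^sub>u Y)"
    and "\<forall>n. projective A (P n)"
    and "augmented_exact B (\<lambda>n. amap \<theta>\<^sub>l (d n)) (amap \<theta>\<^sub>l e) (omap \<theta>\<^sub>l (omap \<theta>\<^sub>u X))"
    and "\<forall>n. \<exists>W \<in> Obj B. homology_isomorphic A P' d' n (omap \<theta>\<^sub>u W)"
    and "induces_H0_iso A P' d' e' (omap \<theta>\<^sub>u Y)"
  shows "(\<exists>F. chain_map_over A P d e P' d' e' (amap \<theta>\<^sub>u f) F) \<and>
         (\<forall>F G. chain_map_over A P d e P' d' e' (amap \<theta>\<^sub>u f) F \<longrightarrow>
                chain_map_over A P d e P' d' e' (amap \<theta>\<^sub>u f) G \<longrightarrow>
                chain_homotopic A P d P' d' F G)"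
proof -
  interpret omega_complexes A B \<theta>\<^sub>l \<theta>\<^sub>u X Y P P' d d' e e'
    using assms unfolding omega_complexes_def omega_complexes_axioms_def by blast
  show ?thesis
    using ex_chain_map chain_map_unique upper.amap_closed[OF assms(4)] by blast
qed

end
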